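(* Let $0<\rho\le\frac13$ and $\mathcal I_\rho=[-\rho,1+\rho]$, and let $\Pi_0,\Pi_1$ be the quasi-interpolation operators defined in the context. Then for all $u\in H\Lambda^0(\mathcal I_\rho)$ there holds $$d^0\Pi_0u=\Pi_1d^0u.$$
   Context: On an interval, $0$-forms are functions and $1$-forms $v\,dx$ are identified with their coefficient $v$; $d^0u=u'$ (weak derivative), and $H\Lambda^0(\mathcal I_\rho)=\{u\in L^2(\mathcal I_\rho): u'\in L^2(\mathcal I_\rho)\}=H^1(\mathcal I_\rho)$. Cut-off functions: $\eta(x)=C\exp\bigl(\frac1{|x|^2-1}\bigr)$ for $|x|<1$, $\eta(x)=0$ for $|x|\ge1$, with $C$ chosen so that $\int_{\mathbb R}\eta=1$; $\eta_l(x)=\frac1\rho\eta(\frac x\rho)$, $\eta_r(x)=\frac1\rho\eta(\frac{x-1}\rho)$; $B_l$ and $B_r$ are the intervals of radius $\rho$ centered at $0$ and $1$. For $y_l\in B_l$, $y_r\in B_r$, perturbed node functionals: for $u\in C^1(\mathcal I_\rho)$, $\widetilde{\mathcal N^0_1}(u)=u'(y_l)$, $\widetilde{\mathcal N^0_2}(u)=u'(y_r)$, $\widetilde{\mathcal N^0_3}(u)=u(y_r)-u(y_l)$, $\widetilde{\mathcal N^0_4}(u)=u(y_r)+u(y_l)$; for $v\in C^0(\mathcal I_\rho)$, $\widetilde{\mathcal N^1_1}(v)=v(y_l)$, $\widetilde{\mathcal N^1_2}(v)=v(y_r)$, $\widetilde{\mathcal N^1_3}(v)=\int_{y_l}^{y_r}v(x)\,dx$.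 Weighted node functionals: $\overline{\mathcal N^k_i}(u)=\int_{B_l}\int_{B_r}\eta_l(\xi_l)\eta_r(\xi_r)\,\widetilde{\mathcal N^k_i}(u)\,d\xi_r\,d\xi_l$, where $\widetilde{\mathcal N^k_i}$ is taken with $y_l=\xi_l$, $y_r=\xi_r$. These are bounded with respect to the $L^2(\mathcal I_\rho)$-norm and are extended by continuity to $L^2(\mathcal I_\rho)$. Basis functions: $\varphi^0_1=x-2x^2+x^3$, $\varphi^0_2=-x^2+x^3$, $\varphi^0_3=-\frac12+3x^2-2x^3$, $\varphi^0_4=\frac12$; $\varphi^1_1=1-4x+3x^2$, $\varphi^1_2=-2x+3x^2$, $\varphi^1_3=6x-6x^2$. Quasi-interpolation operators: $\Pi_0u=\sum_{i=1}^4\overline{\mathcal N^0_i}(u)\varphi^0_i$ on $0$-forms and $\Pi_1v=\sum_{i=1}^3\overline{\mathcal N^1_i}(v)\varphi^1_i$ on $1$-forms, with $u,v\in L^2(\mathcal I_\rho)$. *)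

theory Defs
  imports "HOL-Analysis.Analysis"
begin

definition I_rho :: "real \<Rightarrow> real set" where
  "I_rho \<rho> = {- \<rho>..1 + \<rho>}"

text \<open>Elements of \<open>L\<^sup>2(S)\<close> are represented by functions on the real line of which only the
  restriction to \<open>S\<close> matters; equality in \<open>L\<^sup>2(S)\<close> is equality almost everywhere on \<open>S\<close>.\<close>

definition L2_space :: "real set \<Rightarrow> (real \<Rightarrow> real) set" where
  "L2_space S = {u. u \<in> borel_measurable (lebesgue_on S) \<and>
                    integrable (lebesgue_on S) (\<lambda>x. (u x)\<^sup>2)}"

definition L2_norm :: "real set \<Rightarrow> (real \<Rightarrow> real) \<Rightarrow> real" where
  "L2_norm S u = sqrt (LINT x|lebesgue_on S. (u x)\<^sup>2)"

definition C0_space :: "real set \<Rightarrow> (real \<Rightarrow> real) set" where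
  "C0_space S = {v. continuous_on S v}"

text \<open>Derivatives are taken within \<open>S\<close>, i.e. one-sided at the end points of a closed interval.\<close>

definition C1_space :: "real set \<Rightarrow> (real \<Rightarrow> real) set" where
  "C1_space S = {u. \<exists>u'. (\<forall>x\<in>S. (u has_real_derivative u' x) (at x within S)) \<and>
                        continuous_on S u'}"

definition test_functions :: "real set \<Rightarrow> (real \<Rightarrow> real) set" where
  "test_functions S = {\<phi>. (\<forall>n. (deriv ^^ n) \<phi> differentiable_on UNIV) \<and>
                          compact (closure {x. \<phi> x \<noteq> 0}) \<and>
                          closure {x. \<phi> x \<noteq> 0} \<subseteq> interior S}"

definition has_weak_derivative :: "real set \<Rightarrow> (real \<Rightarrow> real) \<Rightarrow> (real \<Rightarrow> real) \<Rightarrow> bool" where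
  "has_weak_derivative S u v \<longleftrightarrow>
     (\<forall>\<phi>\<in>test_functions S.
        (LINT x|lebesgue_on S. u x * deriv \<phi> x) = - (LINT x|lebesgue_on S. v x * \<phi> x))"

definition HLambda0 :: "real set \<Rightarrow> (real \<Rightarrow> real) set" where
  "HLambda0 S = {u \<in> L2_space S. \<exists>v\<in>L2_space S. has_weak_derivative S u v}"

text \<open>The weak derivative is unique only up to null sets; \<open>d0\<close> picks a representative,
  so identities involving \<open>d0\<close> are to be read almost everywhere.\<close>

definition d0 :: "real set \<Rightarrow> (real \<Rightarrow> real) \<Rightarrow> real \<Rightarrow> real" where
  "d0 S u = (SOME v. v \<in> L2_space S \<and> has_weak_derivative S u v)"

definition bump :: "real \<Rightarrow> real" where
  "bump x = (if \<bar>x\<bar> < 1 then exp (1 / (\<bar>x\<bar>\<^sup>2 - 1)) else 0)"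

definition eta :: "real \<Rightarrow> real" where
  "eta x = 1 / (LINT t|lborel. bump t) * bump x"

definition eta_l :: "real \<Rightarrow> real \<Rightarrow> real" where
  "eta_l \<rho> x = 1 / \<rho> * eta (x / \<rho>)"

definition eta_r :: "real \<Rightarrow> real \<Rightarrow> real" where
  "eta_r \<rho> x = 1 / \<rho> * eta ((x - 1) / \<rho>)"

definition B_l :: "real \<Rightarrow> real set" where
  "B_l \<rho> = cball 0 \<rho>"

definition B_r :: "real \<Rightarrow> real set" where
  "B_r \<rho> = cball 1 \<rho>"

definition node0 :: "real \<Rightarrow> nat \<Rightarrow> real \<Rightarrow> real \<Rightarrow> (real \<Rightarrow> real) \<Rightarrow> real" where
  "node0 \<rho> i y\<^sub>l y\<^sub>r u =
     (if i = 1 then vector_derivative u (at y\<^sub>l within I_rho \<rho>)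
      else if i = 2 then vector_derivative u (at y\<^sub>r within I_rho \<rho>)
      else if i = 3 then u y\<^sub>r - u y\<^sub>l
      else if i = 4 then u y\<^sub>r + u y\<^sub>l
      else 0)"

definition node1 :: "nat \<Rightarrow> real \<Rightarrow> real \<Rightarrow> (real \<Rightarrow> real) \<Rightarrow> real" where
  "node1 i y\<^sub>l y\<^sub>r v =
     (if i = 1 then v y\<^sub>l
      else if i = 2 then v y\<^sub>r
      else if i = 3 then (LBINT x=y\<^sub>l..y\<^sub>r. v x)
      else 0)"

text \<open>The average of a family of functionals \<open>N y\<^sub>l y\<^sub>r\<close>.\<close>

definition weighted ::
  "real \<Rightarrow> (real \<Rightarrow> real \<Rightarrow> (real \<Rightarrow> real) \<Rightarrow> real) \<Rightarrow> (real \<Rightarrow> real) \<Rightarrow> real" where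
  "weighted \<rho> N u =
     (LINT \<xi>\<^sub>l:B_l \<rho>|lborel. (LINT \<xi>\<^sub>r:B_r \<rho>|lborel. eta_l \<rho> \<xi>\<^sub>l * eta_r \<rho> \<xi>\<^sub>r * N \<xi>\<^sub>l \<xi>\<^sub>r u))"

text \<open>Extension by continuity to \<open>L\<^sup>2(S)\<close> of a functional \<open>F\<close> given on a subspace \<open>D\<close>: its value at
  \<open>u\<close> is the common limit of \<open>F (w n)\<close> over all sequences \<open>w\<close> in \<open>D\<close> converging to \<open>u\<close>
  in \<open>L\<^sup>2(S)\<close>. It is meaningful when \<open>D\<close> is dense and \<open>F\<close> is linear and bounded on \<open>D\<close> with respect
  to the norm of \<open>L\<^sup>2(S)\<close>.\<close>

definition L2_extension ::
  "real set \<Rightarrow> (real \<Rightarrow> real) set \<Rightarrow> ((real \<Rightarrow> real) \<Rightarrow> real) \<Rightarrow> (real \<Rightarrow> real) \<Rightarrow> real" where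
  "L2_extension S D F u =
     (THE l. \<forall>w. (\<forall>n::nat. w n \<in> D) \<and> (\<lambda>n. L2_norm S (\<lambda>x. w n x - u x)) \<longlonglongrightarrow> 0
                 \<longrightarrow> (\<lambda>n. F (w n)) \<longlonglongrightarrow> l)"

definition wnode0 :: "real \<Rightarrow> nat \<Rightarrow> (real \<Rightarrow> real) \<Rightarrow> real" where
  "wnode0 \<rho> i = L2_extension (I_rho \<rho>) (C1_space (I_rho \<rho>)) (weighted \<rho> (node0 \<rho> i))"

definition wnode1 :: "real \<Rightarrow> nat \<Rightarrow> (real \<Rightarrow> real) \<Rightarrow> real" where
  "wnode1 \<rho> i = L2_extension (I_rho \<rho>) (C0_space (I_rho \<rho>)) (weighted \<rho> (node1 i))"

definition phi0 :: "nat \<Rightarrow> real \<Rightarrow> real" where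
  "phi0 i x =
     (if i = 1 then x - 2 * x^2 + x^3
      else if i = 2 then - (x^2) + x^3
      else if i = 3 then - 1/2 + 3 * x^2 - 2 * x^3
      else if i = 4 then 1/2
      else 0)"

definition phi1 :: "nat \<Rightarrow> real \<Rightarrow> real" where
  "phi1 i x =
     (if i = 1 then 1 - 4 * x + 3 * x^2
      else if i = 2 then - 2 * x + 3 * x^2
      else if i = 3 then 6 * x - 6 * x^2
      else 0)"

definition Pi0 :: "real \<Rightarrow> (real \<Rightarrow> real) \<Rightarrow> real \<Rightarrow> real" where
  "Pi0 \<rho> u x = (\<Sum>i=1..4. wnode0 \<rho> i u * phi0 i x)"

definition Pi1 :: "real \<Rightarrow> (real \<Rightarrow> real) \<Rightarrow> real \<Rightarrow> real" where
  "Pi1 \<rho> v x = (\<Sum>i=1..3. wnode1 \<rho> i v * phi1 i x)"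

end

theory Submission
  imports Defs
begin

text \<open>Let \<open>v\<close> be the weak derivative of \<open>u\<close> and let continuous \<open>w\<^sub>n\<close> converge to \<open>v\<close> in \<open>L\<^sup>2\<close>. By the
  lemma of du Bois-Reymond, \<open>u\<close> is a constant plus the indefinite integral of \<open>v\<close>, so that the
  antiderivatives \<open>W\<^sub>n\<close> of the \<open>w\<^sub>n\<close> with this constant are \<open>C\<^sup>1\<close> and converge to \<open>u\<close>. The first three
  node functionals on \<open>0\<close>-forms satisfy \<open>N\<^sup>0\<^sub>i(W\<^sub>n) = N\<^sup>1\<^sub>i(w\<^sub>n)\<close> by the fundamental theorem of calculus.
  Their weighted versions are bounded (already for the \<open>L\<^sup>1\<close> norm; for those that evaluate a
  derivative, integrate by parts against the smooth cut-off), so the extensions take the same value at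
  \<open>u\<close> and at \<open>v\<close>. Since \<open>\<phi>\<^sup>1\<^sub>i\<close> is the derivative of \<open>\<phi>\<^sup>0\<^sub>i\<close> for \<open>i \<le> 3\<close> and \<open>\<phi>\<^sup>0\<^sub>4\<close> is constant, the identity
  follows.\<close>

subsection \<open>Smooth functions and test functions\<close>

text \<open>Point values are unbounded in the L2 norm; only their averages extend, and
  \<open>L2_extension\<close> describes an extended value through \<open>THE\<close>, without a
  formula for it. Two such values are therefore compared through the sequences that define them: a
  Lipschitz estimate makes the limit the same for every approximating sequence, so that one
  well-chosen pair of sequences settles each coefficient. Passing from a weak derivative to an
  indefinite integral requires functions that are infinitely differentiable in the sense of iterated
  \<open>deriv\<close> and compactly supported. They are built from one explicit family, polynomials
  times steep flat cut-offs. Orthogonality to this family passes to all polynomials by dominated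
  convergence; Weierstrass approximation then takes the place of mollification.\<close>

definition smooth :: "(real \<Rightarrow> real) \<Rightarrow> bool" where
  "smooth f \<longleftrightarrow> (\<forall>n. (deriv ^^ n) f differentiable_on UNIV)"

text \<open>The iterates of \<open>deriv\<close> never leave \<open>A\<close>. A proof of smoothness
  thus reduces to exhibiting a class that contains the derivatives of its members, with no formula
  for the n-th derivative.\<close>

lemma smooth_coinduct:
  assumes "f \<in> A"
    and step: "\<And>g. g \<in> A \<Longrightarrow> \<exists>g'\<in>A. \<forall>x. (g has_real_derivative g' x) (at x)"
  shows "smooth f"
proof -
  have "deriv g \<in> A" if g: "g \<in> A" for g
  proof -
    obtain g' where "g' \<in> A" "\<forall>x. (g has_real_derivative g' x) (at x)"
      using step[OF g] by blast
    moreover from this have "deriv g = g'"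
      by (intro ext DERIV_imp_deriv) simp
    ultimately show ?thesis
      by simp
  qed
  then have "(deriv ^^ n) f \<in> A" for n
    by (induction n) (use assms in auto)
  then show ?thesis
    unfolding smooth_def differentiable_on_def
    using step unfolding real_differentiable_def by meson
qed

lemma smooth_imp_derivative:
  assumes "smooth f"
  shows "(f has_real_derivative deriv f x) (at x)"
proof -
  have "f differentiable_on UNIV"
    using assms unfolding smooth_def by (metis funpow_0)
  then show ?thesis
    by (simp add: differentiable_on_def DERIV_deriv_iff_real_differentiable)
qed

lemma smooth_deriv: "smooth f \<Longrightarrow> smooth (deriv f)"
  unfolding smooth_def by (metis funpow_Suc_right o_apply)

lemma smooth_imp_continuous_on: "smooth f \<Longrightarrow> continuous_on A f"
  using smooth_imp_derivative DERIV_isCont by (blast intro: continuous_at_imp_continuous_on)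

lemma smooth_antiderivative:
  assumes "\<And>x. (f has_real_derivative g x) (at x)" "smooth g"
  shows "smooth f"
proof (rule smooth_coinduct[of f "{f. \<exists>g. smooth g \<and> (\<forall>x. (f has_real_derivative g x) (at x))}"])
  fix h :: "real \<Rightarrow> real"
  assume "h \<in> {f. \<exists>g. smooth g \<and> (\<forall>x. (f has_real_derivative g x) (at x))}"
  then obtain k where "smooth k" "\<forall>x. (h has_real_derivative k x) (at x)"
    by blast
  then show "\<exists>g'\<in>{f. \<exists>g. smooth g \<and> (\<forall>x. (f has_real_derivative g x) (at x))}.
      \<forall>x. (h has_real_derivative g' x) (at x)"
    by (intro bexI[of _ k] CollectI exI[of _ "deriv k"] conjI allI smooth_deriv smooth_imp_derivative)
      simp_all
qed (intro CollectI exI[of _ g] conjI allI assms)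

lemma smooth_add_scaled:
  assumes "smooth f" "smooth g"
  shows "smooth (\<lambda>x. f x + c * g x)"
proof (rule smooth_coinduct[of _ "{(\<lambda>x. f x + c * g x) |f g. smooth f \<and> smooth g}"])
  fix h assume "h \<in> {(\<lambda>x. f x + c * g x) |f g. smooth f \<and> smooth g}"
  then obtain f g where h: "h = (\<lambda>x. f x + c * g x)" and fg: "smooth f" "smooth g"
    by blast
  have "\<forall>x. (h has_real_derivative deriv f x + c * deriv g x) (at x)"
    unfolding h using fg by (auto intro!: derivative_eq_intros smooth_imp_derivative)
  moreover have "(\<lambda>x. deriv f x + c * deriv g x) \<in> {(\<lambda>x. f x + c * g x) |f g. smooth f \<and> smooth g}"
    by (intro CollectI exI[of _ "deriv f"] exI[of _ "deriv g"] conjI smooth_deriv fg refl)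
  ultimately show "\<exists>g'\<in>{(\<lambda>x. f x + c * g x) |f g. smooth f \<and> smooth g}.
      \<forall>x. (h has_real_derivative g' x) (at x)"
    by (intro bexI[of _ "\<lambda>x. deriv f x + c * deriv g x"])
qed (intro CollectI exI[of _ f] exI[of _ g] conjI assms refl)

text \<open>Single products are not closed under differentiation, but by the Leibniz rule finite
  sums of products are; this is the class to which \<open>smooth_coinduct\<close> is
  applied.\<close>

inductive_set smooth_product_sums :: "(real \<Rightarrow> real) set" where
  prod: "smooth f \<Longrightarrow> smooth g \<Longrightarrow> (\<lambda>x. f x * g x) \<in> smooth_product_sums"
| add: "f \<in> smooth_product_sums \<Longrightarrow> g \<in> smooth_product_sums
    \<Longrightarrow> (\<lambda>x. f x + g x) \<in> smooth_product_sums"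

lemma smooth_mult:
  assumes "smooth f" "smooth g"
  shows "smooth (\<lambda>x. f x * g x)"
proof (rule smooth_coinduct[of _ smooth_product_sums])
  show "(\<lambda>x. f x * g x) \<in> smooth_product_sums"
    using assms by (rule smooth_product_sums.prod)
next
  fix h assume "h \<in> smooth_product_sums"
  then show "\<exists>h'\<in>smooth_product_sums. \<forall>x. (h has_real_derivative h' x) (at x)"
  proof induction
    case (prod f g)
    have "\<forall>x. ((\<lambda>x. f x * g x) has_real_derivative deriv f x * g x + f x * deriv g x) (at x)"
      using prod by (auto intro!: derivative_eq_intros smooth_imp_derivative)
    moreover have "(\<lambda>x. deriv f x * g x + f x * deriv g x) \<in> smooth_product_sums"
      using prod by (intro smooth_product_sums.intros smooth_deriv)
    ultimately show ?case
      by (intro bexI[of _ "\<lambda>x. deriv f x * g x + f x * deriv g x"])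
  next
    case (add f g)
    then obtain f' g' where "f' \<in> smooth_product_sums" "g' \<in> smooth_product_sums"
      "\<forall>x. (f has_real_derivative f' x) (at x)" "\<forall>x. (g has_real_derivative g' x) (at x)"
      by blast
    then show ?case
      by (intro bexI[of _ "\<lambda>x. f' x + g' x"] allI DERIV_add smooth_product_sums.add) auto
  qed
qed

text \<open>Each differentiation brings out a factor \<open>c\<close>; the scalar \<open>k\<close>
  in the invariant class absorbs it.\<close>

lemma smooth_compose_affine:
  assumes "smooth f"
  shows "smooth (\<lambda>x. f (c * x + d))"
proof (rule smooth_coinduct[of _ "{(\<lambda>x. k * f (c * x + d)) |k f. smooth f}"])
  show "(\<lambda>x. f (c * x + d)) \<in> {(\<lambda>x. k * f (c * x + d)) |k f. smooth f}"
    by (intro CollectI exI[of _ 1] exI[of _ f] conjI assms) simp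
next
  fix h assume "h \<in> {(\<lambda>x. k * f (c * x + d)) |k f. smooth f}"
  then obtain k f where h: "h = (\<lambda>x. k * f (c * x + d))" and f: "smooth f"
    by blast
  have "\<forall>x. (h has_real_derivative (k * c) * deriv f (c * x + d)) (at x)"
    unfolding h
    by (auto intro!: derivative_eq_intros DERIV_chain'[where g = f] smooth_imp_derivative f)
  moreover have "(\<lambda>x. (k * c) * deriv f (c * x + d)) \<in> {(\<lambda>x. k * f (c * x + d)) |k f. smooth f}"
    by (intro CollectI exI[of _ "k * c"] exI[of _ "deriv f"] conjI smooth_deriv f refl)
  ultimately show "\<exists>g'\<in>{(\<lambda>x. k * f (c * x + d)) |k f. smooth f}.
      \<forall>x. (h has_real_derivative g' x) (at x)"
    by (intro bexI[of _ "\<lambda>x. (k * c) * deriv f (c * x + d)"])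
qed

lemma smooth_poly: "smooth (poly p)"
proof (rule smooth_coinduct[of _ "range poly"])
  fix h :: "real \<Rightarrow> real" assume "h \<in> range poly"
  then show "\<exists>g'\<in>range poly. \<forall>x. (h has_real_derivative g' x) (at x)"
    using poly_DERIV by blast
qed auto

section \<open>Flat functions and the smoothness of the bump\<close>

text \<open>For \<open>p = 1\<close> this is the classical function exp(-1/x), continued by 0, that
  is smooth but not analytic at 0. The polynomial in \<open>1 / x\<close> makes the family closed
  under differentiation.\<close>

definition exp_flat :: "real poly \<Rightarrow> real \<Rightarrow> real" where
  "exp_flat p x = (if x > 0 then poly p (1 / x) * exp (- (1 / x)) else 0)"

lemma poly_times_exp_minus_tendsto_0:
  fixes p :: "real poly"
  shows "((\<lambda>x. poly p x * exp (- x)) \<longlongrightarrow> 0) at_top"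
proof -
  have "((\<lambda>x. \<Sum>i\<le>degree p. coeff p i * (x ^ i / exp x)) \<longlongrightarrow> (\<Sum>i\<le>degree p. coeff p i * 0)) at_top"
    by (intro tendsto_intros tendsto_power_div_exp_0)
  then show ?thesis
    by (simp add: poly_altdef sum_distrib_right exp_minus divide_inverse mult.assoc)
qed

text \<open>The derivative of \<open>p (1 / x) * exp (- 1 / x)\<close> is again of this form, with \<open>p\<close> replaced by
  \<open>X\<^sup>2 * (p - p')\<close>.\<close>

lemma exp_flat_has_derivative:
  "(exp_flat p has_real_derivative exp_flat (pCons 0 (pCons 0 (p - pderiv p))) x) (at x)"
proof -
  consider "x > 0" | "x < 0" | "x = 0" by linarith
  then show ?thesis
  proof cases
    case 1
    have inv: "((\<lambda>x. 1 / x) has_real_derivative - ((1 / x) * (1 / x))) (at x)"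
      using 1 by (auto intro!: derivative_eq_intros)
    have "((\<lambda>x. poly p (1 / x) * exp (- (1 / x))) has_real_derivative
        poly p (1 / x) * (exp (- (1 / x)) * - (- ((1 / x) * (1 / x))))
        + - ((1 / x) * (1 / x)) * poly (pderiv p) (1 / x) * exp (- (1 / x))) (at x)"
      by (intro DERIV_mult' DERIV_fun_exp DERIV_minus inv
          DERIV_chain'[OF inv poly_DERIV, unfolded mult.commute[of _ "- _"]])
    then have "((\<lambda>x. poly p (1 / x) * exp (- (1 / x))) has_real_derivative
        exp_flat (pCons 0 (pCons 0 (p - pderiv p))) x) (at x)"
      by (rule DERIV_cong) (use 1 in \<open>simp add: exp_flat_def algebra_simps\<close>)
    then show ?thesis
      by (rule has_field_derivative_transform_within_open[of _ _ _ "{0<..}"])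
        (use 1 in \<open>auto simp: exp_flat_def\<close>)
  next
    case 2
    have "((\<lambda>x. 0) has_real_derivative exp_flat (pCons 0 (pCons 0 (p - pderiv p))) x) (at x)"
      using 2 by (auto simp: exp_flat_def)
    then show ?thesis
      by (rule has_field_derivative_transform_within_open[of _ _ _ "{..<0}"])
        (use 2 in \<open>auto simp: exp_flat_def\<close>)
  next
    case 3
    \<comment> \<open>Dividing the increment by \<open>h\<close> multiplies it by
      \<open>1 / h\<close>, which turns \<open>p\<close> into \<open>pCons 0 p\<close>: the
      right-hand difference quotient at 0 is again of the flat form and tends to 0.\<close>
    have "((\<lambda>h. poly (pCons 0 p) (1 / h) * exp (- (1 / h))) \<longlongrightarrow> 0) (at_right (0::real))"
      using filterlim_compose[OF poly_times_exp_minus_tendsto_0[of "pCons 0 p"]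
          filterlim_inverse_at_top_right]
      by (simp add: inverse_eq_divide)
    moreover have "\<forall>\<^sub>F h in at_right 0.
        poly (pCons 0 p) (1 / h) * exp (- (1 / h)) = (exp_flat p (0 + h) - exp_flat p 0) / h"
      by (auto simp: eventually_at_filter exp_flat_def)
    ultimately have r: "((\<lambda>h. (exp_flat p (0 + h) - exp_flat p 0) / h) \<longlongrightarrow> 0) (at_right 0)"
      by (rule Lim_transform_eventually)
    have "\<forall>\<^sub>F h in at_left 0. 0 = (exp_flat p (0 + h) - exp_flat p 0) / h"
      by (auto simp: eventually_at_filter exp_flat_def)
    then have l: "((\<lambda>h. (exp_flat p (0 + h) - exp_flat p 0) / h) \<longlongrightarrow> 0) (at_left 0)"
      by (rule Lim_transform_eventually[OF tendsto_const])
    show ?thesis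
      using filterlim_split_at[OF l r] 3 by (simp add: DERIV_def exp_flat_def)
  qed
qed

lemma smooth_exp_flat: "smooth (exp_flat p)"
proof (rule smooth_coinduct[of _ "range exp_flat"])
  fix h :: "real \<Rightarrow> real" assume "h \<in> range exp_flat"
  then show "\<exists>g'\<in>range exp_flat. \<forall>x. (h has_real_derivative g' x) (at x)"
    using exp_flat_has_derivative by blast
qed auto

text \<open>By partial fractions, 1/(x^2 - 1) = -1/(2x + 2) - 1/(2 - 2x), so the bump is a product
  of two one-sided flat functions, one vanishing for x \<le> -1 and the other for x \<ge> 1.\<close>

lemma smooth_bump: "smooth bump"
proof -
  have "bump x = exp_flat 1 (2 * x + 2) * exp_flat 1 (- 2 * x + 2)" for x
  proof (cases "\<bar>x\<bar> < 1")
    case True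
    then have "1 - x\<^sup>2 \<noteq> 0" "x - 1 \<noteq> 0" "x + 1 \<noteq> 0"
      by (auto simp: power2_eq_1_iff)
    then have "1 / (x\<^sup>2 - 1) = - (1 / (2 * x + 2)) + - (1 / (- 2 * x + 2))"
      by (simp add: divide_simps) (simp add: algebra_simps power2_eq_square)
    then have "exp (1 / (x\<^sup>2 - 1)) = exp (- (1 / (2 * x + 2))) * exp (- (1 / (- 2 * x + 2)))"
      by (metis exp_add)
    moreover have "2 * x + 2 > 0" "- 2 * x + 2 > 0"
      using True by auto
    ultimately show ?thesis
      using True by (simp add: bump_def exp_flat_def)
  qed (auto simp: bump_def exp_flat_def)
  then have "bump = (\<lambda>x. exp_flat 1 (2 * x + 2) * exp_flat 1 (- 2 * x + 2))"
    by blast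
  moreover have "smooth (\<lambda>x. exp_flat 1 (2 * x + 2) * exp_flat 1 (- 2 * x + 2))"
    by (intro smooth_mult smooth_compose_affine smooth_exp_flat)
  ultimately show ?thesis
    by metis
qed

lemma test_functionsI:
  assumes "smooth \<phi>" "{a..b} \<subseteq> interior S" "\<And>x. x \<notin> {a..b} \<Longrightarrow> \<phi> x = 0"
  shows "\<phi> \<in> test_functions S"
proof -
  have "closure {x. \<phi> x \<noteq> 0} \<subseteq> {a..b}"
    using assms(3) by (intro closure_minimal) (fastforce, simp)
  moreover from this have "compact (closure {x. \<phi> x \<noteq> 0})"
    by (metis bounded_closed_interval bounded_subset closed_closure compact_eq_bounded_closed)
  ultimately show ?thesis
    using assms by (auto simp: test_functions_def smooth_def)
qed

lemma test_functions_smooth: "\<phi> \<in> test_functions S \<Longrightarrow> smooth \<phi>"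
  by (simp add: test_functions_def smooth_def)

lemma test_functions_eq_0: "\<phi> \<in> test_functions S \<Longrightarrow> x \<notin> interior S \<Longrightarrow> \<phi> x = 0"
  using closure_subset[of "{x. \<phi> x \<noteq> 0}"] by (auto simp: test_functions_def)

text \<open>A polynomial cut off to the interval between \<open>a\<close> and \<open>b\<close>. The
  steepness \<open>c\<close> is a parameter because the cut-off tends to 1 inside the interval as
  \<open>c\<close> grows.\<close>

definition poly_bump :: "real \<Rightarrow> real poly \<Rightarrow> real \<Rightarrow> real \<Rightarrow> real \<Rightarrow> real" where
  "poly_bump c r a b x = exp_flat 1 (c * (x - a)) * exp_flat 1 (c * (b - x)) * poly r x"

lemma smooth_poly_bump: "smooth (poly_bump c r a b)"
proof -
  have "smooth (\<lambda>x. exp_flat 1 (c * x + - c * a) * exp_flat 1 (- c * x + c * b) * poly r x)"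
    by (intro smooth_mult smooth_compose_affine smooth_exp_flat smooth_poly)
  also have "(\<lambda>x. exp_flat 1 (c * x + - c * a) * exp_flat 1 (- c * x + c * b) * poly r x)
      = poly_bump c r a b"
    by (simp add: poly_bump_def fun_eq_iff algebra_simps)
  finally show ?thesis .
qed

lemma poly_bump_eq_0: "c \<ge> 0 \<Longrightarrow> x \<notin> {a<..<b} \<Longrightarrow> poly_bump c r a b x = 0"
  by (auto simp: poly_bump_def exp_flat_def zero_less_mult_iff)

lemma poly_bump_test_function:
  "c \<ge> 0 \<Longrightarrow> {a..b} \<subseteq> interior S \<Longrightarrow> poly_bump c r a b \<in> test_functions S"
  by (rule test_functionsI[OF smooth_poly_bump]) (auto intro: poly_bump_eq_0)

text \<open>Both cut-off factors lie between 0 and 1. The bound is uniform in \<open>c\<close>,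
  \<open>a\<close> and \<open>b\<close>, and so provides a dominating function when the cut-off is
  removed in the limit.\<close>

lemma abs_poly_bump_le: "\<bar>poly_bump c r a b x\<bar> \<le> \<bar>poly r x\<bar>"
proof -
  have "0 \<le> exp_flat 1 y \<and> exp_flat 1 y \<le> 1" for y
    by (simp add: exp_flat_def)
  then show ?thesis
    unfolding poly_bump_def abs_mult
    by (intro mult_left_le_one_le mult_nonneg_nonneg mult_le_one) (simp_all add: abs_mult)
qed

subsection \<open>Square integrable functions on an interval\<close>

lemma integrable_on_interval_bounded:
  fixes f :: "real \<Rightarrow> real"
  assumes "f \<in> borel_measurable (lebesgue_on {a..b})" "integrable (lebesgue_on {a..b}) g"
    "\<And>x. \<bar>f x\<bar> \<le> g x"
  shows "integrable (lebesgue_on {a..b}) f"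
proof (rule Bochner_Integration.integrable_bound[OF assms(2,1)])
  show "AE x in lebesgue_on {a..b}. norm (f x) \<le> norm (g x)"
    unfolding real_norm_def by (intro AE_I2 order_trans[OF assms(3) abs_ge_self])
qed

lemma AE_lebesgue_on_not_in:
  assumes "negligible N"
  shows "AE x in lebesgue_on {a..b::real}. x \<notin> N"
proof -
  have "AE x in lebesgue. x \<notin> N"
    using assms by (intro AE_not_in) (simp add: negligible_iff_null_sets)
  then have "AE x in lebesgue. x \<in> {a..b} \<longrightarrow> x \<notin> N"
    by (rule eventually_mono) simp
  then show ?thesis
    by (subst AE_restrict_space_iff) simp_all
qed

lemma L2_space_measurable: "u \<in> L2_space S \<Longrightarrow> u \<in> borel_measurable (lebesgue_on S)"
  by (simp add: L2_space_def)

lemma L2_space_square_integrable: "u \<in> L2_space S \<Longrightarrow> integrable (lebesgue_on S) (\<lambda>x. (u x)\<^sup>2)"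
  by (simp add: L2_space_def)

lemma L2_space_mult_integrable:
  assumes "u \<in> L2_space {a..b}" "v \<in> L2_space {a..b}"
  shows "integrable (lebesgue_on {a..b}) (\<lambda>x. u x * v x)"
proof (rule integrable_on_interval_bounded)
  show "integrable (lebesgue_on {a..b}) (\<lambda>x. (u x)\<^sup>2 + (v x)\<^sup>2)"
    using assms L2_space_square_integrable by auto
  show "(\<lambda>x. u x * v x) \<in> borel_measurable (lebesgue_on {a..b})"
    using assms L2_space_measurable by auto
  show "\<bar>u x * v x\<bar> \<le> (u x)\<^sup>2 + (v x)\<^sup>2" for x
  proof -
    have "0 \<le> \<bar>u x\<bar> * \<bar>v x\<bar>"
      by simp
    then show ?thesis
      using sum_squares_bound[of "\<bar>u x\<bar>" "\<bar>v x\<bar>"] unfolding abs_mult power2_abs by linarith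
  qed
qed

lemma continuous_imp_L2_space: "continuous_on {a..b} u \<Longrightarrow> u \<in> L2_space {a..b}"
  unfolding L2_space_def
  by (auto intro!: continuous_imp_integrable_real continuous_intros
      borel_measurable_integrable[OF continuous_imp_integrable_real])

lemma L2_space_integrable: "u \<in> L2_space {a..b} \<Longrightarrow> integrable (lebesgue_on {a..b}) u"
  using L2_space_mult_integrable[of u a b "\<lambda>_. 1"] continuous_imp_L2_space[of a b "\<lambda>_. 1"] by auto

lemma L2_space_add_scaled:
  assumes "u \<in> L2_space {a..b}" "v \<in> L2_space {a..b}"
  shows "(\<lambda>x. u x + c * v x) \<in> L2_space {a..b}"
proof -
  have "integrable (lebesgue_on {a..b}) (\<lambda>x. (u x)\<^sup>2 + 2 * c * (u x * v x) + c\<^sup>2 * (v x)\<^sup>2)"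
    using assms by (intro Bochner_Integration.integrable_add integrable_mult_right
        L2_space_square_integrable L2_space_mult_integrable)
  then have "integrable (lebesgue_on {a..b}) (\<lambda>x. (u x + c * v x)\<^sup>2)"
    by (simp add: power2_sum power_mult_distrib mult_ac add_ac)
  then show ?thesis
    using assms by (auto simp: L2_space_def)
qed

lemma L2_space_diff:
  "u \<in> L2_space {a..b} \<Longrightarrow> v \<in> L2_space {a..b} \<Longrightarrow> (\<lambda>x. u x - v x) \<in> L2_space {a..b}"
  using L2_space_add_scaled[of u a b v "-1"] by simp

text \<open>The inequality of Cauchy and Schwarz for \<open>h\<close> and \<open>1\<close>, read off the nonnegative integral of
  \<open>((b - a) \<bar>h\<bar> - \<integral>\<bar>h\<bar>)\<^sup>2\<close>.\<close>

lemma L1_norm_le_L2_norm: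
  assumes "a < b" "h \<in> L2_space {a..b}"
  shows "(LINT x|lebesgue_on {a..b}. \<bar>h x\<bar>) \<le> sqrt (b - a) * L2_norm {a..b} h"
proof -
  define t where "t = (LINT x|lebesgue_on {a..b}. \<bar>h x\<bar>)"
  define q where "q = (LINT x|lebesgue_on {a..b}. (h x)\<^sup>2)"
  have int: "integrable (lebesgue_on {a..b}) (\<lambda>x. \<bar>h x\<bar>)" "integrable (lebesgue_on {a..b}) (\<lambda>x. (h x)\<^sup>2)"
    "integrable (lebesgue_on {a..b}) (\<lambda>x. t\<^sup>2)"
    using assms L2_space_integrable L2_space_square_integrable
    by (auto intro: continuous_imp_integrable_real)
  have c: "(LINT x|lebesgue_on {a..b}. t\<^sup>2) = (b - a) * t\<^sup>2"
    using assms by (simp add: measure_restrict_space)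
  have "0 \<le> (LINT x|lebesgue_on {a..b}. ((b - a) * \<bar>h x\<bar> - t)\<^sup>2)"
    by simp
  also have "\<dots> = (LINT x|lebesgue_on {a..b}. (b - a)\<^sup>2 * (h x)\<^sup>2 - 2 * (b - a) * t * \<bar>h x\<bar> + t\<^sup>2)"
    by (intro Bochner_Integration.integral_cong refl)
      (simp add: power2_diff power_mult_distrib mult_ac)
  also have "\<dots> = (b - a)\<^sup>2 * q - 2 * (b - a) * t * t + (b - a) * t\<^sup>2"
    using int c by (simp add: t_def q_def)
  also have "\<dots> = (b - a) * ((b - a) * q - t\<^sup>2)"
    by (simp add: power2_eq_square algebra_simps)
  finally have "t\<^sup>2 \<le> (b - a) * q"
    using assms by (simp add: zero_le_mult_iff)
  then have "t \<le> sqrt ((b - a) * q)"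
    by (rule real_le_rsqrt)
  then show ?thesis
    by (simp add: t_def q_def L2_norm_def real_sqrt_mult)
qed

section \<open>Density of continuous functions and of polynomials in L2\<close>

text \<open>A measurable function is an almost everywhere limit of continuous ones. Truncating these
  at height \<open>K\<close> does not change the limit, since the values of \<open>u\<close> already
  lie between \<open>- K\<close> and \<open>K\<close>, and it bounds the error by
  \<open>2 * K\<close>, so that dominated convergence applies.\<close>

lemma continuous_dense_bounded:
  fixes u :: "real \<Rightarrow> real"
  assumes u: "u \<in> borel_measurable (lebesgue_on {a..b})" and K: "\<And>x. \<bar>u x\<bar> \<le> K" and "e > 0"
  shows "\<exists>g. continuous_on {a..b} g \<and> (LINT x|lebesgue_on {a..b}. (g x - u x)\<^sup>2) < e"
proof -
  have "u measurable_on {a..b}"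
    using u by (simp add: measurable_on_iff_borel_measurable)
  then obtain N g where N: "negligible N" and g: "\<And>n. continuous_on UNIV (g n)"
    and lim: "\<And>x. x \<notin> N \<Longrightarrow> (\<lambda>n. g n x) \<longlonglongrightarrow> (if x \<in> {a..b} then u x else 0)"
    unfolding measurable_on_def by blast
  define k where "k n x = max (- K) (min K (g n x))" for n x
  have k: "continuous_on {a..b} (k n)" for n
    unfolding k_def by (intro continuous_intros continuous_on_subset[OF g]) simp
  have "(\<lambda>n. LINT x|lebesgue_on {a..b}. (k n x - u x)\<^sup>2) \<longlonglongrightarrow> (LINT x|lebesgue_on {a..b}. 0)"
  proof (rule integral_dominated_convergence)
    show "integrable (lebesgue_on {a..b}) (\<lambda>x. (2 * K)\<^sup>2)"
      by (auto intro: continuous_imp_integrable_real)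
    show "(\<lambda>x. (k n x - u x)\<^sup>2) \<in> borel_measurable (lebesgue_on {a..b})" for n
      using u L2_space_measurable[OF continuous_imp_L2_space[OF k]] by simp
    have "AE x in lebesgue_on {a..b}. x \<notin> N"
      using N by (rule AE_lebesgue_on_not_in)
    then show "AE x in lebesgue_on {a..b}. (\<lambda>n. (k n x - u x)\<^sup>2) \<longlonglongrightarrow> 0"
    proof (rule AE_mp, intro AE_I2 impI)
      fix x assume "x \<in> space (lebesgue_on {a..b})" "x \<notin> N"
      then have "(\<lambda>n. g n x) \<longlonglongrightarrow> u x"
        using lim[of x] by simp
      then have "(\<lambda>n. (k n x - u x)\<^sup>2) \<longlonglongrightarrow> (max (- K) (min K (u x)) - u x)\<^sup>2"
        unfolding k_def by (intro tendsto_intros)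
      moreover have "max (- K) (min K (u x)) = u x"
        using K[of x] by linarith
      ultimately show "(\<lambda>n. (k n x - u x)\<^sup>2) \<longlonglongrightarrow> 0"
        by simp
    qed
    have "\<bar>k n x - u x\<bar> \<le> \<bar>2 * K\<bar>" for n x
      using K[of x] unfolding k_def by linarith
    then show "AE x in lebesgue_on {a..b}. norm ((k n x - u x)\<^sup>2) \<le> (2 * K)\<^sup>2" for n
      unfolding abs_le_square_iff by simp
  qed simp
  then have "\<forall>\<^sub>F n in sequentially. (LINT x|lebesgue_on {a..b}. (k n x - u x)\<^sup>2) < e"
    using \<open>e > 0\<close> by (simp add: order_tendstoD)
  then show ?thesis
    using k by (auto simp: eventually_sequentially)
qed

text \<open>The triangle inequality without square roots, from (s + t)^2 \<le> 2 s^2 + 2 t^2. The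
  factors 2 explain why the density lemmas aim at \<open>e / 4\<close> in each of two
  stages.\<close>

lemma L2_square_diff_le:
  assumes "u \<in> L2_space {a..b}" "v \<in> L2_space {a..b}" "w \<in> L2_space {a..b}"
  shows "(LINT x|lebesgue_on {a..b}. (u x - w x)\<^sup>2) \<le>
    2 * (LINT x|lebesgue_on {a..b}. (u x - v x)\<^sup>2) + 2 * (LINT x|lebesgue_on {a..b}. (v x - w x)\<^sup>2)"
proof -
  have int: "integrable (lebesgue_on {a..b}) (\<lambda>x. (u x - v x)\<^sup>2)"
    "integrable (lebesgue_on {a..b}) (\<lambda>x. (v x - w x)\<^sup>2)"
    "integrable (lebesgue_on {a..b}) (\<lambda>x. (u x - w x)\<^sup>2)"
    using assms by (intro L2_space_square_integrable L2_space_diff; simp)+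
  have "(u x - w x)\<^sup>2 \<le> 2 * (u x - v x)\<^sup>2 + 2 * (v x - w x)\<^sup>2" for x
    using zero_le_power2[of "(u x - v x) - (v x - w x)"]
    by (simp add: power2_eq_square algebra_simps)
  then have "(LINT x|lebesgue_on {a..b}. (u x - w x)\<^sup>2)
      \<le> (LINT x|lebesgue_on {a..b}. 2 * (u x - v x)\<^sup>2 + 2 * (v x - w x)\<^sup>2)"
    using int by (intro integral_mono) auto
  then show ?thesis
    using int by simp
qed

text \<open>Truncation at height \<open>n\<close> reduces this to the bounded case: the truncated
  function differs from \<open>u\<close> by at most \<open>\<bar>u x\<bar>\<close> and eventually
  agrees with it at every point, so the squared error tends to 0 with \<open>u\<close> squared as
  dominating function.\<close>

lemma continuous_dense_L2:
  assumes u: "u \<in> L2_space {a..b}" and "e > 0"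
  shows "\<exists>g. continuous_on {a..b} g \<and> (LINT x|lebesgue_on {a..b}. (g x - u x)\<^sup>2) < e"
proof -
  define k where "k n x = max (- real n) (min (real n) (u x))" for n x
  have meas: "k n \<in> borel_measurable (lebesgue_on {a..b})" for n
    using L2_space_measurable[OF u] by (simp add: k_def[abs_def])
  have "(\<lambda>n. LINT x|lebesgue_on {a..b}. (k n x - u x)\<^sup>2) \<longlonglongrightarrow> (LINT x|lebesgue_on {a..b}. 0)"
  proof (rule integral_dominated_convergence)
    show "integrable (lebesgue_on {a..b}) (\<lambda>x. (u x)\<^sup>2)"
      using u by (rule L2_space_square_integrable)
    show "(\<lambda>x. (k n x - u x)\<^sup>2) \<in> borel_measurable (lebesgue_on {a..b})" for n
      using meas L2_space_measurable[OF u] by simp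
    have "(\<lambda>n. (k n x - u x)\<^sup>2) \<longlonglongrightarrow> 0" for x
    proof (rule tendsto_eventually)
      obtain m where m: "\<bar>u x\<bar> \<le> real m"
        using real_arch_simple by blast
      show "\<forall>\<^sub>F n in sequentially. (k n x - u x)\<^sup>2 = 0"
        using eventually_ge_at_top[of m] by eventually_elim (use m in \<open>auto simp: k_def\<close>)
    qed
    then show "AE x in lebesgue_on {a..b}. (\<lambda>n. (k n x - u x)\<^sup>2) \<longlonglongrightarrow> 0"
      by simp
    have "\<bar>k n x - u x\<bar> \<le> \<bar>u x\<bar>" for n x
      unfolding k_def by linarith
    then show "AE x in lebesgue_on {a..b}. norm ((k n x - u x)\<^sup>2) \<le> (u x)\<^sup>2" for n
      by (simp add: abs_le_square_iff[symmetric])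
  qed simp
  then have "\<forall>\<^sub>F n in sequentially. (LINT x|lebesgue_on {a..b}. (k n x - u x)\<^sup>2) < e / 4"
    by (rule order_tendstoD(2)) (use \<open>e > 0\<close> in simp)
  then obtain n where n: "(LINT x|lebesgue_on {a..b}. (k n x - u x)\<^sup>2) < e / 4"
    by (auto simp: eventually_sequentially)
  have bound: "\<bar>k n x\<bar> \<le> real n" for x
    unfolding k_def by linarith
  obtain g where g: "continuous_on {a..b} g" "(LINT x|lebesgue_on {a..b}. (g x - k n x)\<^sup>2) < e / 4"
    using continuous_dense_bounded[OF meas bound, of "e / 4"] \<open>e > 0\<close> by auto
  have "integrable (lebesgue_on {a..b}) (\<lambda>x. (k n x)\<^sup>2)"
  proof (rule integrable_on_interval_bounded)
    show "integrable (lebesgue_on {a..b}) (\<lambda>x. (real n)\<^sup>2)"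
      by (auto intro: continuous_imp_integrable_real)
    show "\<bar>(k n x)\<^sup>2\<bar> \<le> (real n)\<^sup>2" for x
      using bound[of x] by (simp add: abs_le_square_iff[symmetric])
  qed (use meas in simp)
  then have "k n \<in> L2_space {a..b}"
    using meas by (simp add: L2_space_def)
  then show ?thesis
    using L2_square_diff_le[OF continuous_imp_L2_space[OF g(1)] _ u, of "k n"] g n
    by (intro exI[of _ g]) linarith
qed

lemma poly_dense_L2:
  assumes "a < b" and u: "u \<in> L2_space {a..b}" and "e > 0"
  shows "\<exists>p. (LINT x|lebesgue_on {a..b}. (poly p x - u x)\<^sup>2) < e"
proof -
  obtain g where g: "continuous_on {a..b} g" "(LINT x|lebesgue_on {a..b}. (g x - u x)\<^sup>2) < e / 4"
    using continuous_dense_L2[OF u, of "e / 4"] \<open>e > 0\<close> by auto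
  define L where "L = b - a"
  \<comment> \<open>A uniform error \<open>d\<close> on an interval of length \<open>L\<close> costs
    at most \<open>L * d\<^sup>2 = e / 4\<close> in the squared L2 distance.\<close>
  define d where "d = sqrt (e / (4 * L))"
  have "L > 0"
    using assms by (simp add: L_def)
  then have "d > 0" and d2: "L * d\<^sup>2 = e / 4"
    using assms by (simp_all add: d_def)
  then obtain q where "real_polynomial_function q" and q: "\<And>x. x \<in> {a..b} \<Longrightarrow> \<bar>g x - q x\<bar> < d"
    using Stone_Weierstrass_real_polynomial_function[OF _ g(1)] by (metis compact_Icc)
  then obtain c n where cn: "q = (\<lambda>x. \<Sum>i\<le>n. c i * x ^ i)"
    using real_polynomial_function_iff_sum by blast
  define p where "p = (\<Sum>i\<le>n. monom (c i) i)"
  have p: "poly p = q"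
    by (simp add: p_def cn poly_sum poly_monom fun_eq_iff)
  have cont: "continuous_on {a..b} (poly p)"
    by (intro continuous_intros)
  have "(LINT x|lebesgue_on {a..b}. (poly p x - g x)\<^sup>2) \<le> (LINT x|lebesgue_on {a..b}. d\<^sup>2)"
  proof (rule integral_mono)
    show "integrable (lebesgue_on {a..b}) (\<lambda>x. (poly p x - g x)\<^sup>2)"
      using cont g by (intro continuous_imp_integrable_real continuous_intros)
    show "integrable (lebesgue_on {a..b}) (\<lambda>x. d\<^sup>2)"
      by (auto intro: continuous_imp_integrable_real)
    fix x assume "x \<in> space (lebesgue_on {a..b})"
    then have "\<bar>poly p x - g x\<bar> \<le> d"
      using q[of x] p by (simp add: abs_minus_commute less_imp_le)
    then show "(poly p x - g x)\<^sup>2 \<le> d\<^sup>2"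
      using \<open>d > 0\<close> by (simp add: abs_le_square_iff[symmetric])
  qed
  also have "\<dots> = e / 4"
    using assms by (simp add: measure_restrict_space flip: d2 L_def)
  finally have "(LINT x|lebesgue_on {a..b}. (poly p x - g x)\<^sup>2) \<le> e / 4" .
  then show ?thesis
    using L2_square_diff_le[OF continuous_imp_L2_space[OF cont] continuous_imp_L2_space[OF g(1)] u] g(2)
    by (intro exI[of _ p]) linarith
qed

section \<open>The fundamental lemma of the calculus of variations\<close>

lemma exp_flat_1_tendsto: "(exp_flat 1 \<longlongrightarrow> 1) at_top"
proof (rule Lim_transform_eventually)
  have "((\<lambda>x::real. 1 / x) \<longlongrightarrow> 0) at_top"
    by (intro tendsto_divide_0[OF tendsto_const] filterlim_at_top_imp_at_infinity filterlim_ident)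
  then have "((\<lambda>x::real. exp (- (1 / x))) \<longlongrightarrow> exp (- 0)) at_top"
    by (intro tendsto_intros)
  then show "((\<lambda>x::real. exp (- (1 / x))) \<longlongrightarrow> 1) at_top"
    by simp
  show "\<forall>\<^sub>F x in at_top. exp (- (1 / x)) = exp_flat 1 x"
    using eventually_gt_at_top[of 0] by eventually_elim (simp add: exp_flat_def)
qed

lemma AE_interval_interior: "AE x in lebesgue_on {a..b::real}. x \<in> {a<..<b}"
proof -
  have "AE x in lebesgue_on {a..b}. x \<notin> {a, b}"
    by (intro AE_lebesgue_on_not_in) simp
  then show ?thesis
    by (rule AE_mp) (intro AE_I2 impI, force)
qed

text \<open>Letting the cut-offs tend to 1 makes \<open>h\<close> orthogonal to every polynomial
  \<open>p\<close>. Then the integral of (p - h)^2 is the sum of those of p^2 and h^2, hence at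
  least that of h^2; by density it can be made arbitrarily small, so h^2 has integral 0.\<close>

lemma fundamental_lemma_L2:
  assumes "a < b" and h: "h \<in> L2_space {a..b}"
    and ortho: "\<And>c r \<alpha> \<beta>. c \<ge> 0 \<Longrightarrow> {\<alpha>..\<beta>} \<subseteq> {a<..<b} \<Longrightarrow>
      (LINT x|lebesgue_on {a..b}. h x * poly_bump c r \<alpha> \<beta> x) = 0"
  shows "AE x in lebesgue_on {a..b}. h x = 0"
proof -
  have poly: "(LINT x|lebesgue_on {a..b}. h x * poly r x) = 0" for r
  proof -
    \<comment> \<open>The support must stay inside the open interval, so each end is moved inwards
      by \<open>1 / real (Suc n)\<close>. With steepness \<open>real (Suc n)\<close> this shifts the
      argument of each cut-off by only 1, and at an interior point it still tends to
      infinity.\<close>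
    define \<phi> where "\<phi> n = poly_bump (real (Suc n)) r (a + 1 / real (Suc n)) (b - 1 / real (Suc n))" for n
    have L2: "poly r \<in> L2_space {a..b}" "\<phi> n \<in> L2_space {a..b}" for n
      unfolding \<phi>_def
      by (intro continuous_imp_L2_space smooth_imp_continuous_on smooth_poly_bump smooth_poly)+
    have "(\<lambda>n. LINT x|lebesgue_on {a..b}. h x * \<phi> n x) \<longlonglongrightarrow> (LINT x|lebesgue_on {a..b}. h x * poly r x)"
    proof (rule integral_dominated_convergence)
      show "integrable (lebesgue_on {a..b}) (\<lambda>x. \<bar>h x * poly r x\<bar>)"
        using L2_space_mult_integrable[OF h L2(1)] by simp
      show "(\<lambda>x. h x * poly r x) \<in> borel_measurable (lebesgue_on {a..b})"
        "(\<lambda>x. h x * \<phi> n x) \<in> borel_measurable (lebesgue_on {a..b})" for n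
        using L2_space_mult_integrable[OF h] L2 by (auto simp: borel_measurable_integrable)
      show "AE x in lebesgue_on {a..b}. norm (h x * \<phi> n x) \<le> \<bar>h x * poly r x\<bar>" for n
        unfolding \<phi>_def using abs_poly_bump_le by (auto simp: abs_mult intro!: mult_left_mono)
      have lim1: "(\<lambda>n. exp_flat 1 (real (Suc n) * y - 1)) \<longlonglongrightarrow> 1" if "y > 0" for y
      proof (rule filterlim_compose[OF exp_flat_1_tendsto])
        have "filterlim (\<lambda>n. y * real (Suc n)) at_top sequentially"
          using that
          by (intro filterlim_tendsto_pos_mult_at_top[OF tendsto_const]
              filterlim_compose[OF filterlim_real_sequentially filterlim_Suc])
        then show "filterlim (\<lambda>n. real (Suc n) * y - 1) at_top sequentially"
          using filterlim_tendsto_add_at_top[OF tendsto_const, of _ _ "-1"]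
          by (simp add: mult.commute)
      qed
      have "(\<lambda>n. h x * \<phi> n x) \<longlonglongrightarrow> h x * poly r x" if "x \<in> {a<..<b}" for x
      proof -
        have "\<phi> n x = exp_flat 1 (real (Suc n) * (x - a) - 1) * exp_flat 1 (real (Suc n) * (b - x) - 1)
            * poly r x" for n
        proof -
          have "real (Suc n) * (x - (a + 1 / real (Suc n))) = real (Suc n) * (x - a) - 1"
            "real (Suc n) * (b - 1 / real (Suc n) - x) = real (Suc n) * (b - x) - 1"
            by (simp_all add: field_simps del: of_nat_Suc)
          then show ?thesis
            unfolding \<phi>_def poly_bump_def by metis
        qed
        then have "\<phi> = (\<lambda>n x. \<phi> n x)" "(\<lambda>n. \<phi> n x) \<longlonglongrightarrow> 1 * 1 * poly r x"
          using that by (simp_all only:) (intro tendsto_intros lim1; simp)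
        then show ?thesis
          by (intro tendsto_intros) simp
      qed
      then show "AE x in lebesgue_on {a..b}. (\<lambda>n. h x * \<phi> n x) \<longlonglongrightarrow> h x * poly r x"
        by (rule eventually_mono[OF AE_interval_interior])
    qed
    moreover have "(LINT x|lebesgue_on {a..b}. h x * \<phi> n x) = 0" for n
    proof -
      have "1 / real (Suc n) > 0"
        by simp
      then have "{a + 1 / real (Suc n)..b - 1 / real (Suc n)} \<subseteq> {a<..<b}"
        by (intro subsetI) (simp only: atLeastAtMost_iff greaterThanLessThan_iff, linarith)
      then show ?thesis
        unfolding \<phi>_def by (intro ortho) auto
    qed
    ultimately show ?thesis
      by (simp add: LIMSEQ_const_iff)
  qed
  have "(LINT x|lebesgue_on {a..b}. (h x)\<^sup>2) \<le> 0"
  proof (rule field_le_epsilon)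
    fix e :: real assume "e > 0"
    then obtain p where p: "(LINT x|lebesgue_on {a..b}. (poly p x - h x)\<^sup>2) < e"
      using poly_dense_L2[OF \<open>a < b\<close> h] by blast
    have L2: "poly p \<in> L2_space {a..b}"
      by (intro continuous_imp_L2_space continuous_intros)
    have int: "integrable (lebesgue_on {a..b}) (\<lambda>x. (poly p x)\<^sup>2)"
      "integrable (lebesgue_on {a..b}) (\<lambda>x. h x * poly p x)"
      "integrable (lebesgue_on {a..b}) (\<lambda>x. (h x)\<^sup>2)"
      using L2 h by (intro L2_space_square_integrable L2_space_mult_integrable; simp)+
    have "(LINT x|lebesgue_on {a..b}. (poly p x - h x)\<^sup>2)
        = (LINT x|lebesgue_on {a..b}. (poly p x)\<^sup>2 - 2 * (h x * poly p x) + (h x)\<^sup>2)"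
      by (intro Bochner_Integration.integral_cong refl) (simp add: power2_diff algebra_simps)
    also have "\<dots> = (LINT x|lebesgue_on {a..b}. (poly p x)\<^sup>2) + (LINT x|lebesgue_on {a..b}. (h x)\<^sup>2)"
      using int poly[of p] by simp
    moreover have "(LINT x|lebesgue_on {a..b}. (poly p x)\<^sup>2) \<ge> 0"
      by simp
    ultimately show "(LINT x|lebesgue_on {a..b}. (h x)\<^sup>2) \<le> 0 + e"
      using p by linarith
  qed
  then have "(LINT x|lebesgue_on {a..b}. (h x)\<^sup>2) = 0"
    by (simp add: order_antisym)
  then have "AE x in lebesgue_on {a..b}. (h x)\<^sup>2 = 0"
    using integral_nonneg_eq_0_iff_AE[OF L2_space_square_integrable[OF h]] by simp
  then show ?thesis
    by simp
qed

subsection \<open>Weak derivatives on an interval\<close>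

lemma has_derivative_imp_has_weak_derivative:
  assumes "a \<le> b"
    and u: "\<And>x. x \<in> {a..b} \<Longrightarrow> (u has_real_derivative v x) (at x within {a..b})"
    and v: "continuous_on {a..b} v"
  shows "has_weak_derivative {a..b} u v"
  unfolding has_weak_derivative_def
proof
  fix \<phi> assume \<phi>: "\<phi> \<in> test_functions {a..b}"
  note smooth = test_functions_smooth[OF \<phi>]
  have cont: "continuous_on {a..b} u" "continuous_on {a..b} \<phi>" "continuous_on {a..b} (deriv \<phi>)"
    using u smooth DERIV_continuous_on
    by (blast intro: smooth_imp_continuous_on smooth_deriv)+
  have int: "integrable (lebesgue_on {a..b}) (\<lambda>x. u x * deriv \<phi> x)"
    "integrable (lebesgue_on {a..b}) (\<lambda>x. v x * \<phi> x)"
    using cont v by (auto intro!: continuous_imp_integrable_real continuous_intros)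
  have "((\<lambda>x. u x * deriv \<phi> x + v x * \<phi> x) has_integral u b * \<phi> b - u a * \<phi> a) {a..b}"
  proof (rule fundamental_theorem_of_calculus[OF \<open>a \<le> b\<close>])
    fix x assume x: "x \<in> {a..b}"
    show "((\<lambda>x. u x * \<phi> x) has_vector_derivative u x * deriv \<phi> x + v x * \<phi> x) (at x within {a..b})"
      unfolding has_real_derivative_iff_has_vector_derivative[symmetric]
      by (intro DERIV_mult' u x has_field_derivative_at_within[OF smooth_imp_derivative[OF smooth]])
  qed
  moreover have "\<phi> a = 0" "\<phi> b = 0"
    using test_functions_eq_0[OF \<phi>] by simp_all
  ultimately have "integral {a..b} (\<lambda>x. u x * deriv \<phi> x + v x * \<phi> x) = 0"
    by (simp add: integral_unique)
  moreover have "(LINT x|lebesgue_on {a..b}. u x * deriv \<phi> x + v x * \<phi> x)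
      = integral {a..b} (\<lambda>x. u x * deriv \<phi> x + v x * \<phi> x)"
    by (intro lebesgue_integral_eq_integral Bochner_Integration.integrable_add int) simp
  ultimately have "(LINT x|lebesgue_on {a..b}. u x * deriv \<phi> x + v x * \<phi> x) = 0"
    by (simp only:)
  then show "(LINT x|lebesgue_on {a..b}. u x * deriv \<phi> x) = - (LINT x|lebesgue_on {a..b}. v x * \<phi> x)"
    using int by simp
qed

lemma continuous_on_interval_bound:
  fixes g :: "real \<Rightarrow> real"
  assumes "continuous_on {a..b} g"
  obtains K where "K \<ge> 0" "\<And>x. x \<in> {a..b} \<Longrightarrow> \<bar>g x\<bar> \<le> K"
proof -
  have "bounded (g ` {a..b})"
    using assms by (intro compact_imp_bounded compact_continuous_image compact_Icc)
  then obtain K where "\<forall>x\<in>{a..b}. \<bar>g x\<bar> \<le> K"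
    by (auto simp: bounded_iff)
  then show ?thesis
    by (intro that[of "max K 0"]) (auto simp: le_max_iff_disj)
qed

lemma tendsto_integral_mult_L1:
  assumes "\<And>n. f n \<in> L2_space {a..b}" "f' \<in> L2_space {a..b}" and g: "continuous_on {a..b} g"
    and lim: "(\<lambda>n. LINT x|lebesgue_on {a..b}. \<bar>f n x - f' x\<bar>) \<longlonglongrightarrow> 0"
  shows "(\<lambda>n. LINT x|lebesgue_on {a..b}. f n x * g x) \<longlonglongrightarrow> (LINT x|lebesgue_on {a..b}. f' x * g x)"
proof -
  obtain K where K: "\<And>x. x \<in> {a..b} \<Longrightarrow> \<bar>g x\<bar> \<le> K"
    using continuous_on_interval_bound[OF g] by blast
  have gL2: "g \<in> L2_space {a..b}"
    using g by (rule continuous_imp_L2_space)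
  have "norm ((LINT x|lebesgue_on {a..b}. f n x * g x) - (LINT x|lebesgue_on {a..b}. f' x * g x))
      \<le> K * (LINT x|lebesgue_on {a..b}. \<bar>f n x - f' x\<bar>)" for n
  proof -
    have diff: "(\<lambda>x. f n x - f' x) \<in> L2_space {a..b}"
      using assms by (intro L2_space_diff)
    have "(LINT x|lebesgue_on {a..b}. f n x * g x) - (LINT x|lebesgue_on {a..b}. f' x * g x)
        = (LINT x|lebesgue_on {a..b}. (f n x - f' x) * g x)"
      using L2_space_mult_integrable gL2 assms by (simp add: left_diff_distrib)
    moreover have "norm (LINT x|lebesgue_on {a..b}. (f n x - f' x) * g x)
        \<le> (LINT x|lebesgue_on {a..b}. norm ((f n x - f' x) * g x))"
      by (rule integral_norm_bound)
    moreover have "(LINT x|lebesgue_on {a..b}. norm ((f n x - f' x) * g x))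
        \<le> (LINT x|lebesgue_on {a..b}. K * \<bar>f n x - f' x\<bar>)"
    proof (rule integral_mono)
      show "integrable (lebesgue_on {a..b}) (\<lambda>x. norm ((f n x - f' x) * g x))"
        using L2_space_mult_integrable[OF diff gL2] by (rule integrable_norm)
      show "integrable (lebesgue_on {a..b}) (\<lambda>x. K * \<bar>f n x - f' x\<bar>)"
        using L2_space_integrable[OF diff] by simp
      show "norm ((f n x - f' x) * g x) \<le> K * \<bar>f n x - f' x\<bar>"
        if "x \<in> space (lebesgue_on {a..b})" for x
        using mult_right_mono[OF K, of x "\<bar>f n x - f' x\<bar>"] that by (simp add: abs_mult mult.commute)
    qed
    ultimately show ?thesis
      unfolding Bochner_Integration.integral_mult_right_zero by (simp only:)
  qed
  then have "(\<lambda>n. (LINT x|lebesgue_on {a..b}. f n x * g x) - (LINT x|lebesgue_on {a..b}. f' x * g x)) \<longlonglongrightarrow> 0"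
    by (rule Lim_null_comparison[OF always_eventually[OF allI]])
      (use tendsto_mult_left[OF lim, of K] in simp)
  then show ?thesis
    by (simp add: LIM_zero_iff)
qed

text \<open>Against a fixed test function both sides of the defining identity are continuous in the
  L1 norm. This gives access to the weak derivative of an indefinite integral whose integrand is
  merely in L2, with no pointwise differentiation.\<close>

lemma has_weak_derivative_limit:
  assumes "\<And>n. u n \<in> L2_space {a..b}" "u' \<in> L2_space {a..b}"
    "\<And>n. v n \<in> L2_space {a..b}" "v' \<in> L2_space {a..b}"
    and weak: "\<And>n. has_weak_derivative {a..b} (u n) (v n)"
    and "(\<lambda>n. LINT x|lebesgue_on {a..b}. \<bar>u n x - u' x\<bar>) \<longlonglongrightarrow> 0"
    and "(\<lambda>n. LINT x|lebesgue_on {a..b}. \<bar>v n x - v' x\<bar>) \<longlonglongrightarrow> 0"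
  shows "has_weak_derivative {a..b} u' v'"
  unfolding has_weak_derivative_def
proof
  fix \<phi> assume \<phi>: "\<phi> \<in> test_functions {a..b}"
  note smooth = test_functions_smooth[OF \<phi>]
  have "(\<lambda>n. LINT x|lebesgue_on {a..b}. u n x * deriv \<phi> x) \<longlonglongrightarrow> (LINT x|lebesgue_on {a..b}. u' x * deriv \<phi> x)"
    using assms smooth by (intro tendsto_integral_mult_L1 smooth_imp_continuous_on smooth_deriv)
  moreover have "(\<lambda>n. - (LINT x|lebesgue_on {a..b}. v n x * \<phi> x)) \<longlonglongrightarrow> - (LINT x|lebesgue_on {a..b}. v' x * \<phi> x)"
    using assms smooth by (intro tendsto_minus tendsto_integral_mult_L1 smooth_imp_continuous_on)
  moreover have "(LINT x|lebesgue_on {a..b}. u n x * deriv \<phi> x) = - (LINT x|lebesgue_on {a..b}. v n x * \<phi> x)" for n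
    using weak \<phi> by (auto simp: has_weak_derivative_def)
  ultimately show "(LINT x|lebesgue_on {a..b}. u' x * deriv \<phi> x) = - (LINT x|lebesgue_on {a..b}. v' x * \<phi> x)"
    by (simp add: LIMSEQ_unique)
qed

text \<open>Since \<open>d0\<close> returns an unspecified weak derivative, this is what identifies
  it, almost everywhere, with one that has been computed. The difference of two weak derivatives is
  orthogonal to every cut-off polynomial.\<close>

lemma has_weak_derivative_unique:
  assumes "a < b" and v: "v \<in> L2_space {a..b}" and w: "w \<in> L2_space {a..b}"
    and weak: "has_weak_derivative {a..b} u v" "has_weak_derivative {a..b} u w"
  shows "AE x in lebesgue_on {a..b}. v x = w x"
proof -
  have "AE x in lebesgue_on {a..b}. v x - w x = 0"
  proof (rule fundamental_lemma_L2[OF \<open>a < b\<close> L2_space_diff[OF v w]])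
    fix c \<alpha> \<beta> :: real and r
    assume "c \<ge> 0" "{\<alpha>..\<beta>} \<subseteq> {a<..<b}"
    then have "poly_bump c r \<alpha> \<beta> \<in> test_functions {a..b}"
      by (intro poly_bump_test_function) auto
    then have "(LINT x|lebesgue_on {a..b}. v x * poly_bump c r \<alpha> \<beta> x)
        = (LINT x|lebesgue_on {a..b}. w x * poly_bump c r \<alpha> \<beta> x)"
      using weak by (auto simp: has_weak_derivative_def)
    moreover have "poly_bump c r \<alpha> \<beta> \<in> L2_space {a..b}"
      by (intro continuous_imp_L2_space smooth_imp_continuous_on smooth_poly_bump)
    ultimately show "(LINT x|lebesgue_on {a..b}. (v x - w x) * poly_bump c r \<alpha> \<beta> x) = 0"
      using v w by (simp add: left_diff_distrib L2_space_mult_integrable)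
  qed
  then show ?thesis
    by simp
qed

text \<open>A compactly supported smooth function of mean zero has a compactly supported smooth
  antiderivative.\<close>

lemma mean_zero_test_function:
  assumes "a < A" "A \<le> B" "B < b" and g: "smooth g"
    and supp: "\<And>x. x \<notin> {A<..<B} \<Longrightarrow> g x = 0" and mean: "integral {a..b} g = 0"
  shows "\<exists>\<theta>\<in>test_functions {a..b}. deriv \<theta> = g"
proof -
  have "isCont g x" for x
    using smooth_imp_derivative[OF g] by (rule DERIV_isCont)
  then obtain G where G: "\<And>x. (G has_real_derivative g x) (at x)"
    using einterval_antiderivative[of "-\<infinity>" "\<infinity>" g]
    by (auto simp: has_real_derivative_iff_has_vector_derivative)
  \<comment> \<open>Off the support of \<open>g\<close>, \<open>G\<close> is constant on the left
    and on the right. The integral of \<open>g\<close> is the difference of the two constants, so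
    mean zero makes them equal, and subtracting the common value makes the antiderivative vanish on
    both sides.\<close>
  have "\<exists>c. \<forall>x\<in>S. G x = c" if "convex S" "S \<inter> {A<..<B} = {}" for S
  proof (rule has_field_derivative_zero_constant[OF \<open>convex S\<close>])
    fix x assume "x \<in> S"
    then have "g x = 0"
      using that supp by blast
    then show "(G has_real_derivative 0) (at x within S)"
      using G[of x] by (metis has_field_derivative_at_within)
  qed
  note const = this
  obtain c where c: "\<And>x. x \<le> A \<Longrightarrow> G x = c"
  proof -
    have "\<exists>c. \<forall>x\<in>{..A}. G x = c"
      by (intro const) auto
    then show thesis
      using that by auto
  qed
  obtain d where d: "\<And>x. x \<ge> B \<Longrightarrow> G x = d"
  proof -
    have "\<exists>c. \<forall>x\<in>{B..}. G x = c"
      by (intro const) auto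
    then show thesis
      using that by auto
  qed
  have "(g has_integral G b - G a) {a..b}"
    using assms(1-3) G
    by (intro fundamental_theorem_of_calculus)
      (auto simp: has_real_derivative_iff_has_vector_derivative[symmetric]
        intro: has_field_derivative_at_within)
  then have "c = d"
    using mean c[of a] d[of b] assms(1-3) by (simp add: integral_unique)
  define \<theta> where "\<theta> x = G x - c" for x
  have \<theta>: "(\<theta> has_real_derivative g x) (at x)" for x
    unfolding \<theta>_def by (auto intro!: derivative_eq_intros G)
  show ?thesis
  proof
    show "deriv \<theta> = g"
      using \<theta> by (intro ext DERIV_imp_deriv)
    show "\<theta> \<in> test_functions {a..b}"
    proof (rule test_functionsI)
      show "smooth \<theta>"
        using \<theta> g by (rule smooth_antiderivative)
      show "{A..B} \<subseteq> interior {a..b}"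
        using assms by auto
      show "\<theta> x = 0" if "x \<notin> {A..B}" for x
        using that c[of x] d[of x] \<open>c = d\<close> by (cases "x \<le> A") (auto simp: \<theta>_def)
    qed
  qed
qed

text \<open>Fix a bump \<open>\<psi>\<close> of positive integral \<open>I\<close>. Any
  \<open>\<phi>\<close> of the family becomes the derivative of a test function once the multiple of
  \<open>\<psi>\<close> with the same integral is subtracted, and \<open>h\<close> is orthogonal to
  such derivatives. Hence the integral of h \<phi> is that of c \<phi>, where \<open>c\<close> is
  the mean of \<open>h\<close> weighted by \<open>\<psi>\<close>, and the fundamental lemma applies
  to h - c.\<close>

lemma du_bois_reymond:
  assumes "a < b" and h: "h \<in> L2_space {a..b}" and weak: "has_weak_derivative {a..b} h (\<lambda>_. 0)"
  shows "\<exists>c. AE x in lebesgue_on {a..b}. h x = c"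
proof -
  \<comment> \<open>The middle third of the interval keeps the support of \<open>\<psi>\<close> away
    from both ends.\<close>
  define a1 where "a1 = (2 * a + b) / 3"
  define b1 where "b1 = (a + 2 * b) / 3"
  define \<psi> where "\<psi> = poly_bump 1 1 a1 b1"
  have ab1: "a < a1" "a1 < b1" "b1 < b"
    using \<open>a < b\<close> by (simp_all add: a1_def b1_def)
  have \<psi>: "smooth \<psi>" "\<psi> \<in> L2_space {a..b}"
    unfolding \<psi>_def by (intro continuous_imp_L2_space smooth_imp_continuous_on smooth_poly_bump)+
  define I where "I = (LINT x|lebesgue_on {a..b}. \<psi> x)"
  have "I > 0"
  proof -
    have cont: "continuous_on S \<psi>" for S
      using \<psi>(1) by (rule smooth_imp_continuous_on)
    have "integral {a1..b1} (\<lambda>x. 0) < integral {a1..b1} \<psi>"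
      using ab1 by (intro integral_less_real cont)
        (auto simp: \<psi>_def poly_bump_def exp_flat_def)
    also have "\<dots> \<le> integral {a..b} \<psi>"
      using ab1 by (intro integral_subset_le integrable_continuous_real cont)
        (auto simp: \<psi>_def poly_bump_def exp_flat_def)
    finally have "0 < integral {a..b} \<psi>"
      by simp
    then show ?thesis
      using L2_space_integrable[OF \<psi>(2)] by (simp add: I_def lebesgue_integral_eq_integral)
  qed
  define c where "c = (LINT x|lebesgue_on {a..b}. h x * \<psi> x) / I"
  have const: "(\<lambda>_. c) \<in> L2_space {a..b}"
    by (intro continuous_imp_L2_space continuous_intros)
  have "AE x in lebesgue_on {a..b}. h x - c = 0"
  proof (rule fundamental_lemma_L2[OF \<open>a < b\<close> L2_space_diff[OF h const]])
    fix k \<alpha> \<beta> :: real and r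
    assume k: "k \<ge> 0" and sub: "{\<alpha>..\<beta>} \<subseteq> {a<..<b}"
    define \<phi> where "\<phi> = poly_bump k r \<alpha> \<beta>"
    have \<phi>: "smooth \<phi>" "\<phi> \<in> L2_space {a..b}"
      unfolding \<phi>_def by (intro continuous_imp_L2_space smooth_imp_continuous_on smooth_poly_bump)+
    define J where "J = (LINT x|lebesgue_on {a..b}. \<phi> x)"
    define g where "g x = \<phi> x + (- J / I) * \<psi> x" for x
    have g: "smooth g"
      unfolding g_def using \<phi>(1) \<psi>(1) by (rule smooth_add_scaled)
    \<comment> \<open>The interval from \<open>A\<close> to \<open>B\<close> must contain both
      supports. If \<open>\<alpha> > \<beta>\<close>, the inclusion \<open>sub\<close> says nothing
      about the position of these points, but then \<open>\<phi>\<close> vanishes identically and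
      the support of \<open>\<psi>\<close> decides alone.\<close>
    define A where "A = (if \<alpha> \<le> \<beta> then min \<alpha> a1 else a1)"
    define B where "B = (if \<alpha> \<le> \<beta> then max \<beta> b1 else b1)"
    have AB: "a < A" "A \<le> B" "B < b"
      using ab1 sub by (auto simp: A_def B_def min_def max_def)
    have "g x = 0" if "x \<notin> {A<..<B}" for x
    proof -
      have "x \<notin> {\<alpha><..<\<beta>}" "x \<notin> {a1<..<b1}"
        using that by (auto simp: A_def B_def split: if_splits)
      then show ?thesis
        using k by (simp add: g_def \<phi>_def \<psi>_def poly_bump_eq_0)
    qed
    moreover have "integral {a..b} g = 0"
    proof -
      have "integrable (lebesgue_on {a..b}) g"
        by (intro continuous_imp_integrable_real smooth_imp_continuous_on g)
      then have "integral {a..b} g = (LINT x|lebesgue_on {a..b}. g x)"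
        by (simp add: lebesgue_integral_eq_integral)
      also have "\<dots> = J + (- J / I) * I"
        unfolding g_def using L2_space_integrable[OF \<phi>(2)] L2_space_integrable[OF \<psi>(2)]
        by (simp add: I_def J_def)
      also have "\<dots> = 0"
        using \<open>I > 0\<close> by simp
      finally show ?thesis .
    qed
    ultimately obtain \<theta> where "\<theta> \<in> test_functions {a..b}" "deriv \<theta> = g"
      using mean_zero_test_function[OF AB g] by blast
    then have "(LINT x|lebesgue_on {a..b}. h x * g x) = 0"
      using weak by (auto simp: has_weak_derivative_def)
    moreover have "(LINT x|lebesgue_on {a..b}. h x * g x)
        = (LINT x|lebesgue_on {a..b}. h x * \<phi> x + (- J / I) * (h x * \<psi> x))"
      by (simp add: g_def algebra_simps)
    moreover have "\<dots> = (LINT x|lebesgue_on {a..b}. h x * \<phi> x) + (- J / I) * (c * I)"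
      using L2_space_mult_integrable[OF h \<phi>(2)] L2_space_mult_integrable[OF h \<psi>(2)] \<open>I > 0\<close>
      by (simp add: c_def)
    ultimately have "(LINT x|lebesgue_on {a..b}. h x * \<phi> x) = c * J"
      using \<open>I > 0\<close> by simp
    then show "(LINT x|lebesgue_on {a..b}. (h x - c) * poly_bump k r \<alpha> \<beta> x) = 0"
      using L2_space_mult_integrable[OF h \<phi>(2)] L2_space_integrable[OF \<phi>(2)]
      by (simp add: left_diff_distrib J_def flip: \<phi>_def)
  qed
  then show ?thesis
    by auto
qed

text \<open>The bound does not depend on \<open>x\<close>: convergence of integrands in L1 becomes
  uniform convergence of their indefinite integrals.\<close>

lemma abs_indefinite_integral_le:
  fixes f :: "real \<Rightarrow> real"
  assumes f: "integrable (lebesgue_on {a..b}) f" and x: "x \<in> {a..b}"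
  shows "\<bar>integral {a..x} f\<bar> \<le> (LINT x|lebesgue_on {a..b}. \<bar>f x\<bar>)"
proof -
  have int: "f integrable_on {a..b}" "(\<lambda>x. \<bar>f x\<bar>) integrable_on {a..b}"
    using f by (auto intro!: integrable_on_lebesgue_on)
  then have sub: "f integrable_on {a..x}" "(\<lambda>x. \<bar>f x\<bar>) integrable_on {a..x}"
    using x by (auto intro: integrable_on_subinterval)
  then have "\<bar>integral {a..x} f\<bar> \<le> integral {a..x} (\<lambda>x. \<bar>f x\<bar>)"
    using integral_norm_bound_integral[of f "{a..x}" "\<lambda>x. \<bar>f x\<bar>"] by simp
  also have "\<dots> \<le> integral {a..b} (\<lambda>x. \<bar>f x\<bar>)"
    using sub int x by (intro integral_subset_le) auto
  also have "\<dots> = (LINT x|lebesgue_on {a..b}. \<bar>f x\<bar>)"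
    using f by (simp add: lebesgue_integral_eq_integral)
  finally show ?thesis .
qed

lemma LINT_le_const:
  fixes f :: "real \<Rightarrow> real"
  assumes "a \<le> b" "continuous_on {a..b} f" "\<And>x. x \<in> {a..b} \<Longrightarrow> f x \<le> K"
  shows "(LINT x|lebesgue_on {a..b}. f x) \<le> (b - a) * K"
proof -
  have "(LINT x|lebesgue_on {a..b}. f x) \<le> (LINT x|lebesgue_on {a..b}. K)"
    using assms by (intro integral_mono continuous_imp_integrable_real continuous_intros) auto
  then show ?thesis
    using assms(1) by (simp add: measure_restrict_space)
qed

lemma indefinite_integral_has_derivative:
  fixes w :: "real \<Rightarrow> real"
  assumes "continuous_on {a..b} w" "x \<in> {a..b}"
  shows "((\<lambda>x. integral {a..x} w) has_real_derivative w x) (at x within {a..b})"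
  unfolding has_real_derivative_iff_has_vector_derivative
  using assms by (rule integral_has_vector_derivative)

text \<open>The antiderivatives converge uniformly to the indefinite integral \<open>U\<close> of
  \<open>v\<close>, with error at most the L1 distance \<open>t n\<close>. As a limit,
  \<open>U\<close> has weak derivative \<open>v\<close>, so \<open>u - U\<close> has weak derivative
  0 and is almost everywhere a constant \<open>c\<close>. This one \<open>c\<close> serves all
  \<open>n\<close>, and the L2 error is at most \<open>sqrt (b - a) * t n\<close>.\<close>

lemma approximate_by_antiderivatives:
  assumes "a < b" and u: "u \<in> L2_space {a..b}" and v: "v \<in> L2_space {a..b}"
    and weak: "has_weak_derivative {a..b} u v"
    and w: "\<And>n. continuous_on {a..b} (w n)"
    and lim: "(\<lambda>n. LINT x|lebesgue_on {a..b}. \<bar>w n x - v x\<bar>) \<longlonglongrightarrow> 0"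
  shows "\<exists>c. (\<lambda>n. L2_norm {a..b} (\<lambda>x. (integral {a..x} (w n) + c) - u x)) \<longlonglongrightarrow> 0"
proof -
  define W where "W n x = integral {a..x} (w n)" for n x
  define U where "U x = integral {a..x} v" for x
  define t where "t n = (LINT x|lebesgue_on {a..b}. \<bar>w n x - v x\<bar>)" for n
  have wL2: "w n \<in> L2_space {a..b}" for n
    using w by (rule continuous_imp_L2_space)
  have vint: "v integrable_on {a..b}" and wint: "w n integrable_on {a..b}" for n
    using L2_space_integrable[OF v] L2_space_integrable[OF wL2] by (auto intro: integrable_on_lebesgue_on)
  have Wc: "continuous_on {a..b} (W n)" and Uc: "continuous_on {a..b} U" for n
    unfolding W_def U_def using vint wint by (auto intro: indefinite_integral_continuous_1)
  have bound: "\<bar>W n x - U x\<bar> \<le> t n" if "x \<in> {a..b}" for n x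
  proof -
    have "v integrable_on {a..x}" "w n integrable_on {a..x}"
      using that integrable_on_subinterval[OF vint, of a x] integrable_on_subinterval[OF wint, of a x]
      by simp_all
    then have "W n x - U x = integral {a..x} (\<lambda>x. w n x - v x)"
      by (simp add: W_def U_def Henstock_Kurzweil_Integration.integral_diff)
    then show ?thesis
      unfolding t_def
      using abs_indefinite_integral_le[OF L2_space_integrable[OF L2_space_diff[OF wL2 v]] that] by simp
  qed
  have t: "t \<longlonglongrightarrow> 0"
    using lim by (simp add: t_def[abs_def])
  have "has_weak_derivative {a..b} U v"
  proof (rule has_weak_derivative_limit[of W _ _ _ w])
    show "has_weak_derivative {a..b} (W n) (w n)" for n
      unfolding W_def using \<open>a < b\<close> w
      by (intro has_derivative_imp_has_weak_derivative indefinite_integral_has_derivative) auto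
    have "(LINT x|lebesgue_on {a..b}. \<bar>W n x - U x\<bar>) \<le> (b - a) * t n" for n
      using \<open>a < b\<close> bound Wc Uc by (intro LINT_le_const continuous_intros) auto
    then have "\<forall>n. norm (LINT x|lebesgue_on {a..b}. \<bar>W n x - U x\<bar>) \<le> (b - a) * t n"
      by simp
    moreover have "(\<lambda>n. (b - a) * t n) \<longlonglongrightarrow> 0"
      using tendsto_mult_left[OF t, of "b - a"] by simp
    ultimately show "(\<lambda>n. LINT x|lebesgue_on {a..b}. \<bar>W n x - U x\<bar>) \<longlonglongrightarrow> 0"
      by (rule Lim_null_comparison[OF always_eventually])
  qed (use Wc Uc wL2 v lim in \<open>auto intro: continuous_imp_L2_space\<close>)
  note weakU = this
  have UL2: "U \<in> L2_space {a..b}"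
    using Uc by (rule continuous_imp_L2_space)
  have "has_weak_derivative {a..b} (\<lambda>x. u x - U x) (\<lambda>_. 0)"
    unfolding has_weak_derivative_def
  proof
    fix \<phi> assume \<phi>: "\<phi> \<in> test_functions {a..b}"
    then have "deriv \<phi> \<in> L2_space {a..b}"
      by (intro continuous_imp_L2_space smooth_imp_continuous_on smooth_deriv test_functions_smooth)
    then have "(LINT x|lebesgue_on {a..b}. (u x - U x) * deriv \<phi> x)
        = (LINT x|lebesgue_on {a..b}. u x * deriv \<phi> x) - (LINT x|lebesgue_on {a..b}. U x * deriv \<phi> x)"
      using u UL2 by (simp add: left_diff_distrib L2_space_mult_integrable)
    then show "(LINT x|lebesgue_on {a..b}. (u x - U x) * deriv \<phi> x) = - (LINT x|lebesgue_on {a..b}. 0 * \<phi> x)"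
      using \<phi> weak weakU by (simp add: has_weak_derivative_def)
  qed
  then obtain c where c: "AE x in lebesgue_on {a..b}. u x - U x = c"
    using du_bois_reymond[OF \<open>a < b\<close> L2_space_diff[OF u UL2]] by blast
  have le: "norm (L2_norm {a..b} (\<lambda>x. (W n x + c) - u x)) \<le> sqrt (b - a) * t n" for n
  proof -
    have "(LINT x|lebesgue_on {a..b}. ((W n x + c) - u x)\<^sup>2) = (LINT x|lebesgue_on {a..b}. (W n x - U x)\<^sup>2)"
    proof (rule integral_cong_AE)
      show "AE x in lebesgue_on {a..b}. ((W n x + c) - u x)\<^sup>2 = (W n x - U x)\<^sup>2"
        using c by (rule eventually_mono) auto
    qed (use L2_space_measurable[OF u] L2_space_measurable[OF UL2]
        L2_space_measurable[OF continuous_imp_L2_space[OF Wc]] in auto)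
    also have "\<dots> \<le> (b - a) * (t n)\<^sup>2"
    proof (rule LINT_le_const)
      show "(W n x - U x)\<^sup>2 \<le> (t n)\<^sup>2" if "x \<in> {a..b}" for x
        using power_mono[OF bound[OF that, of n], of 2] by simp
    qed (use \<open>a < b\<close> Wc Uc in \<open>auto intro!: continuous_intros\<close>)
    finally have "L2_norm {a..b} (\<lambda>x. (W n x + c) - u x) \<le> sqrt ((b - a) * (t n)\<^sup>2)"
      by (simp add: L2_norm_def)
    moreover have "t n \<ge> 0"
      by (simp add: t_def)
    ultimately show ?thesis
      by (simp add: real_sqrt_mult L2_norm_def)
  qed
  moreover have "(\<lambda>n. sqrt (b - a) * t n) \<longlonglongrightarrow> 0"
    using tendsto_mult_left[OF t, of "sqrt (b - a)"] by simp
  ultimately have "(\<lambda>n. L2_norm {a..b} (\<lambda>x. (W n x + c) - u x)) \<longlonglongrightarrow> 0"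
    by (rule Lim_null_comparison[OF always_eventually[OF allI]])
  then show ?thesis
    unfolding W_def by blast
qed

lemma d0_weak_derivative:
  assumes "u \<in> HLambda0 S"
  shows "d0 S u \<in> L2_space S \<and> has_weak_derivative S u (d0 S u)"
proof -
  have "\<exists>v. v \<in> L2_space S \<and> has_weak_derivative S u v"
    using assms by (auto simp: HLambda0_def)
  then show ?thesis
    unfolding d0_def by (rule someI_ex)
qed

subsection \<open>Extension by continuity\<close>

lemma L1_tendsto_of_L2_norm_tendsto:
  assumes "a < b" "u \<in> L2_space {a..b}" "\<And>n. w n \<in> L2_space {a..b}"
    and lim: "(\<lambda>n. L2_norm {a..b} (\<lambda>x. w n x - u x)) \<longlonglongrightarrow> 0"
  shows "(\<lambda>n. LINT x|lebesgue_on {a..b}. \<bar>w n x - u x\<bar>) \<longlonglongrightarrow> 0"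
proof (rule Lim_null_comparison[OF always_eventually])
  show "\<forall>n. norm (LINT x|lebesgue_on {a..b}. \<bar>w n x - u x\<bar>)
      \<le> sqrt (b - a) * L2_norm {a..b} (\<lambda>x. w n x - u x)"
    using L1_norm_le_L2_norm[OF \<open>a < b\<close> L2_space_diff] assms by simp
  show "(\<lambda>n. sqrt (b - a) * L2_norm {a..b} (\<lambda>x. w n x - u x)) \<longlonglongrightarrow> 0"
    using tendsto_mult_left[OF lim, of "sqrt (b - a)"] by simp
qed

text \<open>For a linear functional on a subspace this is boundedness in the L1 norm, which on a
  bounded interval implies boundedness in the L2 norm. It is phrased with differences of values
  because the extension compares values along two sequences.\<close>

definition L1_lipschitz :: "real \<Rightarrow> real \<Rightarrow> (real \<Rightarrow> real) set \<Rightarrow> ((real \<Rightarrow> real) \<Rightarrow> real) \<Rightarrow> bool" where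
  "L1_lipschitz a b D F \<longleftrightarrow> (\<exists>C\<ge>0. \<forall>f\<in>D. \<forall>g\<in>D.
     \<bar>F f - F g\<bar> \<le> C * (LINT x|lebesgue_on {a..b}. \<bar>f x - g x\<bar>))"

text \<open>The estimate holds on \<open>D\<close>, whereas the limit \<open>u\<close> may lie
  outside it; values at two members of \<open>D\<close> are therefore compared through their
  distances to \<open>u\<close>.\<close>

lemma L1_lipschitz_diff_le:
  assumes D: "D \<subseteq> L2_space {a..b}" and F: "L1_lipschitz a b D F" and u: "u \<in> L2_space {a..b}"
  shows "\<exists>C. \<forall>f\<in>D. \<forall>g\<in>D. \<bar>F f - F g\<bar> \<le> C * (LINT x|lebesgue_on {a..b}. \<bar>f x - u x\<bar>)
    + C * (LINT x|lebesgue_on {a..b}. \<bar>g x - u x\<bar>)"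
proof -
  obtain C where C: "C \<ge> 0" and bound: "\<And>f g. f \<in> D \<Longrightarrow> g \<in> D \<Longrightarrow>
      \<bar>F f - F g\<bar> \<le> C * (LINT x|lebesgue_on {a..b}. \<bar>f x - g x\<bar>)"
    using F by (auto simp: L1_lipschitz_def)
  show ?thesis
  proof (intro exI[of _ C] ballI)
    fix f g assume fg: "f \<in> D" "g \<in> D"
    have "f \<in> L2_space {a..b}" "g \<in> L2_space {a..b}"
      using D fg by auto
    then have int: "integrable (lebesgue_on {a..b}) (\<lambda>x. f x - u x)"
      "integrable (lebesgue_on {a..b}) (\<lambda>x. g x - u x)"
      "integrable (lebesgue_on {a..b}) (\<lambda>x. f x - g x)"
      using u by (intro L2_space_integrable L2_space_diff; simp)+
    have "(LINT x|lebesgue_on {a..b}. \<bar>f x - g x\<bar>)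
        \<le> (LINT x|lebesgue_on {a..b}. \<bar>f x - u x\<bar> + \<bar>g x - u x\<bar>)"
      by (intro integral_mono Bochner_Integration.integrable_add integrable_abs int) simp
    also have "\<dots> = (LINT x|lebesgue_on {a..b}. \<bar>f x - u x\<bar>) + (LINT x|lebesgue_on {a..b}. \<bar>g x - u x\<bar>)"
      by (intro Bochner_Integration.integral_add integrable_abs int)
    finally have "C * (LINT x|lebesgue_on {a..b}. \<bar>f x - g x\<bar>)
        \<le> C * ((LINT x|lebesgue_on {a..b}. \<bar>f x - u x\<bar>) + (LINT x|lebesgue_on {a..b}. \<bar>g x - u x\<bar>))"
      using C by (rule mult_left_mono)
    then show "\<bar>F f - F g\<bar> \<le> C * (LINT x|lebesgue_on {a..b}. \<bar>f x - u x\<bar>)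
        + C * (LINT x|lebesgue_on {a..b}. \<bar>g x - u x\<bar>)"
      using bound[OF fg] by (simp add: distrib_left)
  qed
qed

lemma L1_lipschitz_convergent:
  assumes "a < b" and D: "D \<subseteq> L2_space {a..b}" and F: "L1_lipschitz a b D F"
    and u: "u \<in> L2_space {a..b}" and w: "\<And>n. w n \<in> D"
    and lim: "(\<lambda>n. L2_norm {a..b} (\<lambda>x. w n x - u x)) \<longlonglongrightarrow> 0"
  shows "convergent (\<lambda>n. F (w n))"
proof (rule Cauchy_convergent, rule metric_CauchyI)
  obtain C where diff_le: "\<forall>f\<in>D. \<forall>g\<in>D.
      \<bar>F f - F g\<bar> \<le> C * (LINT x|lebesgue_on {a..b}. \<bar>f x - u x\<bar>)
        + C * (LINT x|lebesgue_on {a..b}. \<bar>g x - u x\<bar>)"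
    using L1_lipschitz_diff_le[OF D F u] by (elim exE)
  define t where "t n = C * (LINT x|lebesgue_on {a..b}. \<bar>w n x - u x\<bar>)" for n
  have "(\<lambda>n. LINT x|lebesgue_on {a..b}. \<bar>w n x - u x\<bar>) \<longlonglongrightarrow> 0"
    using D w by (intro L1_tendsto_of_L2_norm_tendsto[OF \<open>a < b\<close> u _ lim]) auto
  then have t: "t \<longlonglongrightarrow> 0"
    unfolding t_def using tendsto_mult_left[of _ 0 _ C] by simp
  fix e :: real assume "e > 0"
  then have "\<forall>\<^sub>F n in sequentially. t n < e / 2"
    by (intro order_tendstoD(2)[OF t]) simp
  then obtain N where N: "\<And>n. n \<ge> N \<Longrightarrow> t n < e / 2"
    by (auto simp: eventually_sequentially)
  show "\<exists>N. \<forall>m\<ge>N. \<forall>n\<ge>N. dist (F (w m)) (F (w n)) < e"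
  proof (intro exI allI impI)
    fix m n assume "m \<ge> N" "n \<ge> N"
    then have "t m < e / 2" "t n < e / 2"
      using N by auto
    moreover have "\<bar>F (w m) - F (w n)\<bar> \<le> t m + t n"
      unfolding t_def by (intro diff_le[rule_format] w)
    ultimately show "dist (F (w m)) (F (w n)) < e"
      by (simp add: dist_real_def)
  qed
qed

text \<open>The description by \<open>THE\<close> demands existence and uniqueness. The estimate
  forces every approximating sequence to share the limit \<open>l\<close> of the sequence
  \<open>w\<close>; that \<open>w\<close> is itself such a sequence excludes any other value, since
  without an approximating sequence the condition would hold vacuously.\<close>

lemma L2_extension_eq:
  assumes "a < b" and D: "D \<subseteq> L2_space {a..b}" and F: "L1_lipschitz a b D F"
    and u: "u \<in> L2_space {a..b}" and w: "\<And>n. w n \<in> D"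
    and lim: "(\<lambda>n. L2_norm {a..b} (\<lambda>x. w n x - u x)) \<longlonglongrightarrow> 0"
    and l: "(\<lambda>n. F (w n)) \<longlonglongrightarrow> l"
  shows "L2_extension {a..b} D F u = l"
  unfolding L2_extension_def
proof (rule the_equality)
  obtain C where diff_le: "\<forall>f\<in>D. \<forall>g\<in>D.
      \<bar>F f - F g\<bar> \<le> C * (LINT x|lebesgue_on {a..b}. \<bar>f x - u x\<bar>)
        + C * (LINT x|lebesgue_on {a..b}. \<bar>g x - u x\<bar>)"
    using L1_lipschitz_diff_le[OF D F u] by (elim exE)
  have L1: "(\<lambda>n. C * (LINT x|lebesgue_on {a..b}. \<bar>v n x - u x\<bar>)) \<longlonglongrightarrow> 0"
    if "\<And>n. v n \<in> D" "(\<lambda>n. L2_norm {a..b} (\<lambda>x. v n x - u x)) \<longlonglongrightarrow> 0" for v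
  proof -
    have "(\<lambda>n. LINT x|lebesgue_on {a..b}. \<bar>v n x - u x\<bar>) \<longlonglongrightarrow> 0"
      using D that by (intro L1_tendsto_of_L2_norm_tendsto[OF \<open>a < b\<close> u]) auto
    then show ?thesis
      using tendsto_mult_left[of _ 0 _ C] by simp
  qed
  show "\<forall>v. (\<forall>n. v n \<in> D) \<and> (\<lambda>n. L2_norm {a..b} (\<lambda>x. v n x - u x)) \<longlonglongrightarrow> 0 \<longrightarrow> (\<lambda>n. F (v n)) \<longlonglongrightarrow> l"
  proof (intro allI impI)
    fix v assume v: "(\<forall>n. v n \<in> D) \<and> (\<lambda>n. L2_norm {a..b} (\<lambda>x. v n x - u x)) \<longlonglongrightarrow> 0"
    have "(\<lambda>n. F (v n) - F (w n)) \<longlonglongrightarrow> 0"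
    proof (rule Lim_null_comparison[OF always_eventually])
      show "\<forall>n. norm (F (v n) - F (w n)) \<le> C * (LINT x|lebesgue_on {a..b}. \<bar>v n x - u x\<bar>)
          + C * (LINT x|lebesgue_on {a..b}. \<bar>w n x - u x\<bar>)"
        using diff_le v w by simp
      show "(\<lambda>n. C * (LINT x|lebesgue_on {a..b}. \<bar>v n x - u x\<bar>)
          + C * (LINT x|lebesgue_on {a..b}. \<bar>w n x - u x\<bar>)) \<longlonglongrightarrow> 0"
        using tendsto_add[OF L1[of v] L1[of w]] v w lim by simp
    qed
    from tendsto_add[OF this l] show "(\<lambda>n. F (v n)) \<longlonglongrightarrow> l"
      by simp
  qed
  fix m
  assume "\<forall>v. (\<forall>n. v n \<in> D) \<and> (\<lambda>n. L2_norm {a..b} (\<lambda>x. v n x - u x)) \<longlonglongrightarrow> 0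
      \<longrightarrow> (\<lambda>n. F (v n)) \<longlonglongrightarrow> m"
  then have "(\<lambda>n. F (w n)) \<longlonglongrightarrow> m"
    using w lim by simp
  then show "m = l"
    using l by (rule LIMSEQ_unique)
qed

lemma continuous_approximating_sequence:
  assumes "v \<in> L2_space {a..b}"
  shows "\<exists>w. (\<forall>n. continuous_on {a..b} (w n)) \<and> (\<lambda>n. L2_norm {a..b} (\<lambda>x. w n x - v x)) \<longlonglongrightarrow> 0"
proof -
  have "\<exists>g. continuous_on {a..b} g \<and> (LINT x|lebesgue_on {a..b}. (g x - v x)\<^sup>2) < 1 / real (Suc n)" for n
    by (rule continuous_dense_L2[OF assms]) simp
  then have "\<exists>w. \<forall>n. continuous_on {a..b} (w n)
      \<and> (LINT x|lebesgue_on {a..b}. (w n x - v x)\<^sup>2) < 1 / real (Suc n)"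
    by (intro choice allI)
  then obtain w where w: "\<And>n. continuous_on {a..b} (w n)"
    "\<And>n. (LINT x|lebesgue_on {a..b}. (w n x - v x)\<^sup>2) < 1 / real (Suc n)"
    by auto
  have "(\<lambda>n. LINT x|lebesgue_on {a..b}. (w n x - v x)\<^sup>2) \<longlonglongrightarrow> 0"
  proof (rule Lim_null_comparison[OF always_eventually])
    show "\<forall>n. norm (LINT x|lebesgue_on {a..b}. (w n x - v x)\<^sup>2) \<le> 1 / real (Suc n)"
      using w(2) by (simp add: less_imp_le)
  qed (rule LIMSEQ_Suc[OF lim_1_over_n])
  then have "(\<lambda>n. sqrt (LINT x|lebesgue_on {a..b}. (w n x - v x)\<^sup>2)) \<longlonglongrightarrow> sqrt 0"
    by (rule tendsto_real_sqrt)
  then show ?thesis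
    using w(1) by (intro exI[of _ w]) (simp add: L2_norm_def)
qed

subsection \<open>Weighted averages\<close>

lemma smooth_scaled_bump: "smooth (\<lambda>x. k * bump (c * x + d))"
proof -
  have "smooth (\<lambda>x. poly [:k:] x * bump (c * x + d))"
    by (intro smooth_mult smooth_poly smooth_compose_affine smooth_bump)
  then show ?thesis
    by simp
qed

lemma smooth_eta_l: "smooth (eta_l \<rho>)"
  using smooth_scaled_bump[of "1 / \<rho> * (1 / (LINT t|lborel. bump t))" "1 / \<rho>" 0]
  by (simp add: eta_l_def[abs_def] eta_def)

lemma smooth_eta_r: "smooth (eta_r \<rho>)"
  using smooth_scaled_bump[of "1 / \<rho> * (1 / (LINT t|lborel. bump t))" "1 / \<rho>" "- 1 / \<rho>"]
  by (simp add: eta_r_def[abs_def] eta_def diff_divide_distrib)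

lemma eta_boundary:
  assumes "\<rho> > 0"
  shows "eta_l \<rho> (- \<rho>) = 0" "eta_l \<rho> \<rho> = 0" "eta_r \<rho> (1 - \<rho>) = 0" "eta_r \<rho> (1 + \<rho>) = 0"
  using assms by (simp_all add: eta_l_def eta_r_def eta_def bump_def)

lemma B_l_eq: "B_l \<rho> = {- \<rho>..\<rho>}" and B_r_eq: "B_r \<rho> = {1 - \<rho>..1 + \<rho>}"
  by (simp_all add: B_l_def B_r_def cball_eq_atLeastAtMost)

text \<open>The functionals treated here depend on the two nodes additively. The double average then
  splits into one-dimensional averages, each multiplied by the total mass of the other
  cut-off.\<close>

lemma weighted_separable:
  assumes N: "\<And>x y. x \<in> {- \<rho>..\<rho>} \<Longrightarrow> y \<in> {1 - \<rho>..1 + \<rho>} \<Longrightarrow> N x y u = p x + q y"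
    and p: "continuous_on {- \<rho>..\<rho>} p" and q: "continuous_on {1 - \<rho>..1 + \<rho>} q"
  shows "weighted \<rho> N u =
    (LINT y:{1 - \<rho>..1 + \<rho>}|lborel. eta_r \<rho> y) * (LINT x:{- \<rho>..\<rho>}|lborel. eta_l \<rho> x * p x) +
    (LINT x:{- \<rho>..\<rho>}|lborel. eta_l \<rho> x) * (LINT y:{1 - \<rho>..1 + \<rho>}|lborel. eta_r \<rho> y * q y)"
proof -
  define E where "E = (LINT y:{1 - \<rho>..1 + \<rho>}|lborel. eta_r \<rho> y)"
  define Q where "Q = (LINT y:{1 - \<rho>..1 + \<rho>}|lborel. eta_r \<rho> y * q y)"
  have cont: "continuous_on A (eta_l \<rho>)" "continuous_on A (eta_r \<rho>)" for A
    by (intro smooth_imp_continuous_on smooth_eta_l smooth_eta_r)+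
  have inner: "(LINT y:{1 - \<rho>..1 + \<rho>}|lborel. eta_l \<rho> x * eta_r \<rho> y * N x y u)
      = E * (eta_l \<rho> x * p x) + Q * eta_l \<rho> x" if x: "x \<in> {- \<rho>..\<rho>}" for x
  proof -
    have "(LINT y:{1 - \<rho>..1 + \<rho>}|lborel. eta_l \<rho> x * eta_r \<rho> y * N x y u)
        = (LINT y:{1 - \<rho>..1 + \<rho>}|lborel. (eta_l \<rho> x * p x) * eta_r \<rho> y + eta_l \<rho> x * (eta_r \<rho> y * q y))"
      using N[OF x] by (intro set_lebesgue_integral_cong) (auto simp: algebra_simps)
    also have "\<dots> = (LINT y:{1 - \<rho>..1 + \<rho>}|lborel. (eta_l \<rho> x * p x) * eta_r \<rho> y)
        + (LINT y:{1 - \<rho>..1 + \<rho>}|lborel. eta_l \<rho> x * (eta_r \<rho> y * q y))"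
      using q by (intro set_integral_add borel_integrable_atLeastAtMost' continuous_intros cont)
    finally show ?thesis
      by (simp add: E_def Q_def mult.commute)
  qed
  have "weighted \<rho> N u = (LINT x:{- \<rho>..\<rho>}|lborel. E * (eta_l \<rho> x * p x) + Q * eta_l \<rho> x)"
    unfolding weighted_def B_l_eq B_r_eq using inner by (intro set_lebesgue_integral_cong) auto
  also have "\<dots> = (LINT x:{- \<rho>..\<rho>}|lborel. E * (eta_l \<rho> x * p x)) + (LINT x:{- \<rho>..\<rho>}|lborel. Q * eta_l \<rho> x)"
    using p by (intro set_integral_add borel_integrable_atLeastAtMost' continuous_intros cont)
  finally show ?thesis
    by (simp add: E_def Q_def mult.commute)
qed

section \<open>Lipschitz estimates for averages\<close>

lemma L1_lipschitz_lincomb: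
  assumes "L1_lipschitz a b D F" "L1_lipschitz a b D G"
  shows "L1_lipschitz a b D (\<lambda>f. \<alpha> * F f + \<beta> * G f)"
proof -
  obtain C1 C2 where C: "C1 \<ge> 0" "C2 \<ge> 0"
    "\<And>f g. f \<in> D \<Longrightarrow> g \<in> D \<Longrightarrow> \<bar>F f - F g\<bar> \<le> C1 * (LINT x|lebesgue_on {a..b}. \<bar>f x - g x\<bar>)"
    "\<And>f g. f \<in> D \<Longrightarrow> g \<in> D \<Longrightarrow> \<bar>G f - G g\<bar> \<le> C2 * (LINT x|lebesgue_on {a..b}. \<bar>f x - g x\<bar>)"
    using assms by (auto simp: L1_lipschitz_def)
  show ?thesis
    unfolding L1_lipschitz_def
  proof (intro exI[of _ "\<bar>\<alpha>\<bar> * C1 + \<bar>\<beta>\<bar> * C2"] conjI ballI)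
    fix f g assume fg: "f \<in> D" "g \<in> D"
    define I where "I = (LINT x|lebesgue_on {a..b}. \<bar>f x - g x\<bar>)"
    have "(\<alpha> * F f + \<beta> * G f) - (\<alpha> * F g + \<beta> * G g) = \<alpha> * (F f - F g) + \<beta> * (G f - G g)"
      by (simp add: algebra_simps)
    also have "\<bar>\<dots>\<bar> \<le> \<bar>\<alpha>\<bar> * \<bar>F f - F g\<bar> + \<bar>\<beta>\<bar> * \<bar>G f - G g\<bar>"
      by (metis abs_mult abs_triangle_ineq)
    also have "\<dots> \<le> \<bar>\<alpha>\<bar> * (C1 * I) + \<bar>\<beta>\<bar> * (C2 * I)"
      unfolding I_def using C fg by (intro add_mono mult_left_mono) auto
    finally show "\<bar>(\<alpha> * F f + \<beta> * G f) - (\<alpha> * F g + \<beta> * G g)\<bar>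
        \<le> (\<bar>\<alpha>\<bar> * C1 + \<bar>\<beta>\<bar> * C2) * (LINT x|lebesgue_on {a..b}. \<bar>f x - g x\<bar>)"
      by (simp add: I_def algebra_simps)
  qed (use C in auto)
qed

lemma L1_lipschitz_scale: "L1_lipschitz a b D F \<Longrightarrow> L1_lipschitz a b D (\<lambda>f. \<alpha> * F f)"
  using L1_lipschitz_lincomb[of a b D F F \<alpha> 0] by simp

lemma L1_lipschitz_cong:
  assumes "L1_lipschitz a b D F" "\<And>f. f \<in> D \<Longrightarrow> G f = F f"
  shows "L1_lipschitz a b D G"
  using assms unfolding L1_lipschitz_def by simp

lemma L1_lipschitz_subset:
  "L1_lipschitz a b D F \<Longrightarrow> D' \<subseteq> D \<Longrightarrow> L1_lipschitz a b D' F"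
  unfolding L1_lipschitz_def by (meson subsetD)

text \<open>This is the gain from averaging: a point value has no bound in the L1 norm, but an
  integral against a continuous weight has the maximum of the weight as Lipschitz constant.\<close>

lemma L1_lipschitz_average:
  assumes e: "continuous_on {c..d} e" and sub: "{c..d} \<subseteq> {a..b}"
  shows "L1_lipschitz a b (C0_space {a..b}) (\<lambda>f. LINT x:{c..d}|lborel. e x * f x)"
proof -
  obtain K where K: "K \<ge> 0" "\<And>x. x \<in> {c..d} \<Longrightarrow> \<bar>e x\<bar> \<le> K"
    using continuous_on_interval_bound[OF e] by blast
  show ?thesis
    unfolding L1_lipschitz_def
  proof (intro exI[of _ K] conjI ballI)
    fix f g assume "f \<in> C0_space {a..b}" "g \<in> C0_space {a..b}"
    then have cont: "continuous_on {a..b} f" "continuous_on {a..b} g"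
      by (simp_all add: C0_space_def)
    then have cont': "continuous_on {c..d} f" "continuous_on {c..d} g"
      using sub continuous_on_subset by blast+
    have "(LINT x:{c..d}|lborel. e x * f x) - (LINT x:{c..d}|lborel. e x * g x)
        = (LINT x:{c..d}|lborel. e x * f x - e x * g x)"
      using cont' e by (intro set_integral_diff(2)[symmetric] borel_integrable_atLeastAtMost' continuous_intros)
    also have "\<dots> = integral {c..d} (\<lambda>x. e x * f x - e x * g x)"
      using cont' e by (intro set_borel_integral_eq_integral borel_integrable_atLeastAtMost' continuous_intros)
    also have "\<bar>\<dots>\<bar> \<le> integral {c..d} (\<lambda>x. K * \<bar>f x - g x\<bar>)"
    proof -
      have "norm (integral {c..d} (\<lambda>x. e x * f x - e x * g x)) \<le> integral {c..d} (\<lambda>x. K * \<bar>f x - g x\<bar>)"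
      proof (rule integral_norm_bound_integral)
        show "norm (e x * f x - e x * g x) \<le> K * \<bar>f x - g x\<bar>" if "x \<in> {c..d}" for x
          using mult_right_mono[OF K(2)[OF that], of "\<bar>f x - g x\<bar>"]
          by (simp add: abs_mult flip: right_diff_distrib)
      qed (use cont' e in \<open>intro integrable_continuous_real continuous_intros; simp\<close>)+
      then show ?thesis
        by simp
    qed
    also have "\<dots> \<le> integral {a..b} (\<lambda>x. K * \<bar>f x - g x\<bar>)"
      using sub cont cont' K
      by (intro integral_subset_le integrable_continuous_real continuous_intros) auto
    also have "\<dots> = K * integral {a..b} (\<lambda>x. \<bar>f x - g x\<bar>)"
      by simp
    also have "integral {a..b} (\<lambda>x. \<bar>f x - g x\<bar>) = (LINT x|lebesgue_on {a..b}. \<bar>f x - g x\<bar>)"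
      using cont by (intro lebesgue_integral_eq_integral[symmetric] continuous_imp_integrable_real
          continuous_intros) simp_all
    finally show "\<bar>(LINT x:{c..d}|lborel. e x * f x) - (LINT x:{c..d}|lborel. e x * g x)\<bar>
        \<le> K * (LINT x|lebesgue_on {a..b}. \<bar>f x - g x\<bar>)" .
  qed (rule K)
qed

text \<open>Indefinite integrals differ uniformly by at most the L1 distance of the integrands;
  integrating this over the interval gives the extra factor \<open>b - a\<close>. It serves the
  functional that integrates between the nodes.\<close>

lemma L1_lipschitz_indefinite_integral:
  assumes "a \<le> b" and F: "L1_lipschitz a b (C0_space {a..b}) F"
  shows "L1_lipschitz a b (C0_space {a..b}) (\<lambda>f. F (\<lambda>x. integral {a..x} f))"
proof -
  obtain C where C: "C \<ge> 0" "\<And>f g. f \<in> C0_space {a..b} \<Longrightarrow> g \<in> C0_space {a..b} \<Longrightarrow>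
      \<bar>F f - F g\<bar> \<le> C * (LINT x|lebesgue_on {a..b}. \<bar>f x - g x\<bar>)"
    using F by (auto simp: L1_lipschitz_def)
  show ?thesis
    unfolding L1_lipschitz_def
  proof (intro exI[of _ "C * (b - a)"] conjI ballI)
    fix f g assume "f \<in> C0_space {a..b}" "g \<in> C0_space {a..b}"
    then have cont: "continuous_on {a..b} f" "continuous_on {a..b} g"
      by (simp_all add: C0_space_def)
    then have int: "f integrable_on {a..b}" "g integrable_on {a..b}"
      by (simp_all add: integrable_continuous_real)
    then have cont': "continuous_on {a..b} (\<lambda>x. integral {a..x} f)" "continuous_on {a..b} (\<lambda>x. integral {a..x} g)"
      by (simp_all add: indefinite_integral_continuous_1)
    define I where "I = (LINT x|lebesgue_on {a..b}. \<bar>f x - g x\<bar>)"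
    have "\<bar>integral {a..x} f - integral {a..x} g\<bar> \<le> I" if x: "x \<in> {a..b}" for x
    proof -
      have "f integrable_on {a..x}" "g integrable_on {a..x}"
        using integrable_on_subinterval[OF int(1), of a x] integrable_on_subinterval[OF int(2), of a x] x
        by simp_all
      then have "integral {a..x} f - integral {a..x} g = integral {a..x} (\<lambda>x. f x - g x)"
        by (simp add: Henstock_Kurzweil_Integration.integral_diff)
      moreover have "integrable (lebesgue_on {a..b}) (\<lambda>x. f x - g x)"
        using cont by (intro continuous_imp_integrable_real continuous_intros)
      ultimately show ?thesis
        unfolding I_def using abs_indefinite_integral_le[OF _ x] by simp
    qed
    then have "(LINT x|lebesgue_on {a..b}. \<bar>integral {a..x} f - integral {a..x} g\<bar>) \<le> (b - a) * I"
      using \<open>a \<le> b\<close> cont' by (intro LINT_le_const continuous_intros) auto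
    then have "C * (LINT x|lebesgue_on {a..b}. \<bar>integral {a..x} f - integral {a..x} g\<bar>) \<le> C * ((b - a) * I)"
      using C(1) by (rule mult_left_mono)
    moreover have "\<bar>F (\<lambda>x. integral {a..x} f) - F (\<lambda>x. integral {a..x} g)\<bar>
        \<le> C * (LINT x|lebesgue_on {a..b}. \<bar>integral {a..x} f - integral {a..x} g\<bar>)"
      using cont' by (intro C(2)) (simp_all add: C0_space_def)
    ultimately show "\<bar>F (\<lambda>x. integral {a..x} f) - F (\<lambda>x. integral {a..x} g)\<bar>
        \<le> C * (b - a) * (LINT x|lebesgue_on {a..b}. \<bar>f x - g x\<bar>)"
      by (simp add: I_def mult.assoc)
  qed (use C \<open>a \<le> b\<close> in simp)
qed

lemma average_by_parts:
  assumes "c \<le> d" and e: "smooth e" "e c = 0" "e d = 0"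
    and u: "\<And>x. x \<in> {c..d} \<Longrightarrow> (u has_real_derivative u' x) (at x within {c..d})"
    and u': "continuous_on {c..d} u'"
  shows "(LINT x:{c..d}|lborel. e x * u' x) = - (LINT x:{c..d}|lborel. deriv e x * u x)"
proof -
  have cont: "continuous_on {c..d} u" "continuous_on {c..d} e" "continuous_on {c..d} (deriv e)"
    using u e(1) DERIV_continuous_on
    by (blast intro: smooth_imp_continuous_on smooth_deriv)+
  have int: "set_integrable lborel {c..d} (\<lambda>x. e x * u' x)"
    "set_integrable lborel {c..d} (\<lambda>x. deriv e x * u x)"
    using cont u' by (auto intro!: borel_integrable_atLeastAtMost' continuous_intros)
  have "((\<lambda>x. e x * u' x + deriv e x * u x) has_integral e d * u d - e c * u c) {c..d}"
  proof (rule fundamental_theorem_of_calculus[OF \<open>c \<le> d\<close>])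
    fix x assume x: "x \<in> {c..d}"
    show "((\<lambda>x. e x * u x) has_vector_derivative e x * u' x + deriv e x * u x) (at x within {c..d})"
      unfolding has_real_derivative_iff_has_vector_derivative[symmetric]
      by (intro DERIV_mult' u x has_field_derivative_at_within[OF smooth_imp_derivative[OF e(1)]])
  qed
  then have "integral {c..d} (\<lambda>x. e x * u' x + deriv e x * u x) = 0"
    using e by (simp add: integral_unique)
  moreover have "(LINT x:{c..d}|lborel. e x * u' x + deriv e x * u x)
      = integral {c..d} (\<lambda>x. e x * u' x + deriv e x * u x)"
    by (intro set_borel_integral_eq_integral set_integral_add(1) int)
  moreover have "(LINT x:{c..d}|lborel. e x * u' x + deriv e x * u x)
      = (LINT x:{c..d}|lborel. e x * u' x) + (LINT x:{c..d}|lborel. deriv e x * u x)"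
    by (intro set_integral_add(2) int)
  ultimately show ?thesis
    by linarith
qed

lemma C1_space_subset_C0_space: "C1_space S \<subseteq> C0_space S"
  by (auto simp: C1_space_def C0_space_def intro: DERIV_continuous_on)

text \<open>Within a nondegenerate interval the one-sided derivative at an end point is unique. This
  matters because the extreme nodes \<open>- \<rho>\<close> and \<open>1 + \<rho>\<close> are the
  end points of \<open>I_rho \<rho>\<close>.\<close>

lemma vector_derivative_within_interval:
  assumes "(u has_real_derivative d) (at x within {a..b})" "a < b" "x \<in> {a..b}"
  shows "vector_derivative u (at x within {a..b}) = d"
  using assms vector_derivative_within_cbox[of a b x u d]
  by (simp add: has_real_derivative_iff_has_vector_derivative)

lemma interval_integral_antiderivative:
  fixes w :: "real \<Rightarrow> real"
  assumes w: "continuous_on {a..b} w" and "x \<in> {a..b}" "y \<in> {a..b}"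
    and W: "\<And>x. x \<in> {a..b} \<Longrightarrow> (W has_real_derivative w x) (at x within {a..b})"
  shows "(LBINT t=x..y. w t) = W y - W x"
proof (rule interval_integral_FTC_finite)
  have sub: "{min x y..max x y} \<subseteq> {a..b}"
    using assms by auto
  show "continuous_on {min x y..max x y} w"
    using w sub by (rule continuous_on_subset)
  show "(W has_vector_derivative w t) (at t within {min x y..max x y})"
    if "min x y \<le> t" "t \<le> max x y" for t
  proof -
    have "t \<in> {a..b}"
      using that sub by (auto simp del: min.bounded_iff)
    from DERIV_subset[OF W[OF this] sub] show ?thesis
      by (simp add: has_real_derivative_iff_has_vector_derivative)
  qed
qed

subsection \<open>The node functionals\<close>

definition avg_l :: "real \<Rightarrow> (real \<Rightarrow> real) \<Rightarrow> real" where
  "avg_l \<rho> f = (LINT x:{- \<rho>..\<rho>}|lborel. eta_l \<rho> x * f x)"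

definition avg_r :: "real \<Rightarrow> (real \<Rightarrow> real) \<Rightarrow> real" where
  "avg_r \<rho> f = (LINT x:{1 - \<rho>..1 + \<rho>}|lborel. eta_r \<rho> x * f x)"

lemma L1_lipschitz_avg:
  assumes "\<rho> > 0"
  shows "L1_lipschitz (- \<rho>) (1 + \<rho>) (C0_space {- \<rho>..1 + \<rho>}) (avg_l \<rho>)"
    "L1_lipschitz (- \<rho>) (1 + \<rho>) (C0_space {- \<rho>..1 + \<rho>}) (avg_r \<rho>)"
  unfolding avg_l_def[abs_def] avg_r_def[abs_def] using assms
  by (intro L1_lipschitz_average smooth_imp_continuous_on smooth_eta_l smooth_eta_r; simp)+

text \<open>In the third functional the nodes occur as limits of integration. Writing the integral
  as a difference of values of one indefinite integral, based at \<open>- \<rho>\<close>, separates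
  them. The shape of the right-hand side is the one that \<open>L1_lipschitz_lincomb\<close>
  expects.\<close>

lemma weighted_node1:
  assumes "\<rho> > 0" and v: "v \<in> C0_space (I_rho \<rho>)"
  shows "weighted \<rho> (node1 1) v = avg_r \<rho> (\<lambda>_. 1) * avg_l \<rho> v"
    "weighted \<rho> (node1 2) v = avg_l \<rho> (\<lambda>_. 1) * avg_r \<rho> v"
    "weighted \<rho> (node1 3) v = avg_l \<rho> (\<lambda>_. 1) * avg_r \<rho> (\<lambda>x. integral {- \<rho>..x} v)
      + - avg_r \<rho> (\<lambda>_. 1) * avg_l \<rho> (\<lambda>x. integral {- \<rho>..x} v)"
proof -
  have v: "continuous_on {- \<rho>..1 + \<rho>} v"
    using v by (simp add: C0_space_def I_rho_def)
  have V: "continuous_on {- \<rho>..1 + \<rho>} (\<lambda>x. integral {- \<rho>..x} v)"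
    using v by (simp add: indefinite_integral_continuous_1 integrable_continuous_real)
  have sub: "{- \<rho>..\<rho>} \<subseteq> {- \<rho>..1 + \<rho>}" "{1 - \<rho>..1 + \<rho>} \<subseteq> {- \<rho>..1 + \<rho>}"
    using \<open>\<rho> > 0\<close> by auto
  note cont = continuous_on_subset[OF v sub(1)] continuous_on_subset[OF v sub(2)]
    continuous_on_subset[OF V sub(1)] continuous_on_subset[OF V sub(2)]
  show "weighted \<rho> (node1 1) v = avg_r \<rho> (\<lambda>_. 1) * avg_l \<rho> v"
    by (subst weighted_separable[where p = v and q = "\<lambda>_. 0"])
      (simp_all add: cont node1_def avg_l_def avg_r_def)
  show "weighted \<rho> (node1 2) v = avg_l \<rho> (\<lambda>_. 1) * avg_r \<rho> v"
    by (subst weighted_separable[where p = "\<lambda>_. 0" and q = v])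
      (simp_all add: cont node1_def avg_l_def avg_r_def)
  have "weighted \<rho> (node1 3) v = avg_r \<rho> (\<lambda>_. 1) * avg_l \<rho> (\<lambda>x. - integral {- \<rho>..x} v)
      + avg_l \<rho> (\<lambda>_. 1) * avg_r \<rho> (\<lambda>x. integral {- \<rho>..x} v)"
  proof (subst weighted_separable[where p = "\<lambda>x. - integral {- \<rho>..x} v"
          and q = "\<lambda>x. integral {- \<rho>..x} v"])
    fix x y assume "x \<in> {- \<rho>..\<rho>}" "y \<in> {1 - \<rho>..1 + \<rho>}"
    then have "x \<in> {- \<rho>..1 + \<rho>}" "y \<in> {- \<rho>..1 + \<rho>}"
      using sub by blast+
    from interval_integral_antiderivative[OF v this indefinite_integral_has_derivative[OF v]]
    show "node1 3 x y v = - integral {- \<rho>..x} v + integral {- \<rho>..y} v"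
      by (simp add: node1_def)
  qed (use cont in \<open>auto intro: continuous_on_minus simp: avg_l_def avg_r_def\<close>)
  then show "weighted \<rho> (node1 3) v = avg_l \<rho> (\<lambda>_. 1) * avg_r \<rho> (\<lambda>x. integral {- \<rho>..x} v)
      + - avg_r \<rho> (\<lambda>_. 1) * avg_l \<rho> (\<lambda>x. integral {- \<rho>..x} v)"
    by (simp add: avg_l_def set_lebesgue_integral_def)
qed

lemma L1_lipschitz_node1:
  assumes "\<rho> > 0" and i: "i \<in> {1, 2, 3}"
  shows "L1_lipschitz (- \<rho>) (1 + \<rho>) (C0_space (I_rho \<rho>)) (weighted \<rho> (node1 i))"
proof -
  note avg = L1_lipschitz_avg[OF \<open>\<rho> > 0\<close>, folded I_rho_def]
  have le: "- \<rho> \<le> 1 + \<rho>"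
    using \<open>\<rho> > 0\<close> by simp
  note avg_integral = avg[unfolded I_rho_def, THEN L1_lipschitz_indefinite_integral[OF le], folded I_rho_def]
  consider "i = 1" | "i = 2" | "i = 3"
    using i by auto
  then show ?thesis
  proof cases
    case 1
    show ?thesis
      unfolding 1 by (rule L1_lipschitz_cong[OF L1_lipschitz_scale[OF avg(1)]])
        (rule weighted_node1[OF \<open>\<rho> > 0\<close>])
  next
    case 2
    show ?thesis
      unfolding 2 by (rule L1_lipschitz_cong[OF L1_lipschitz_scale[OF avg(2)]])
        (rule weighted_node1[OF \<open>\<rho> > 0\<close>])
  next
    case 3
    show ?thesis
      unfolding 3 by (rule L1_lipschitz_cong[OF L1_lipschitz_lincomb[OF avg_integral(2,1)]])
        (rule weighted_node1[OF \<open>\<rho> > 0\<close>])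
  qed
qed

text \<open>No derivative of \<open>u\<close> is left on the right-hand sides: the cut-offs vanish
  at the ends of their intervals, so integration by parts leaves no boundary terms. The new weights
  \<open>deriv (eta_l \<rho>)\<close> and \<open>deriv (eta_r \<rho>)\<close> are continuous, which
  is all that \<open>L1_lipschitz_average\<close> asks of a weight.\<close>

lemma weighted_node0:
  assumes "\<rho> > 0" and u: "u \<in> C1_space (I_rho \<rho>)"
  shows "weighted \<rho> (node0 \<rho> 1) u
      = - avg_r \<rho> (\<lambda>_. 1) * (LINT x:{- \<rho>..\<rho>}|lborel. deriv (eta_l \<rho>) x * u x)"
    "weighted \<rho> (node0 \<rho> 2) u
      = - avg_l \<rho> (\<lambda>_. 1) * (LINT x:{1 - \<rho>..1 + \<rho>}|lborel. deriv (eta_r \<rho>) x * u x)"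
    "weighted \<rho> (node0 \<rho> 3) u
      = avg_l \<rho> (\<lambda>_. 1) * avg_r \<rho> u + - avg_r \<rho> (\<lambda>_. 1) * avg_l \<rho> u"
proof -
  obtain u' where "\<forall>x\<in>{- \<rho>..1 + \<rho>}. (u has_real_derivative u' x) (at x within {- \<rho>..1 + \<rho>})"
    and v: "continuous_on {- \<rho>..1 + \<rho>} u'"
    using u by (auto simp: C1_space_def I_rho_def)
  then have u': "(u has_real_derivative u' x) (at x within {- \<rho>..1 + \<rho>})" if "x \<in> {- \<rho>..1 + \<rho>}" for x
    using that by blast
  have uc: "continuous_on {- \<rho>..1 + \<rho>} u"
    using u' by (rule DERIV_continuous_on)
  have sub: "{- \<rho>..\<rho>} \<subseteq> {- \<rho>..1 + \<rho>}" "{1 - \<rho>..1 + \<rho>} \<subseteq> {- \<rho>..1 + \<rho>}"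
    using \<open>\<rho> > 0\<close> by auto
  note cont = continuous_on_subset[OF uc sub(1)] continuous_on_subset[OF uc sub(2)]
    continuous_on_subset[OF v sub(1)] continuous_on_subset[OF v sub(2)]
  have d: "vector_derivative u (at x within {- \<rho>..1 + \<rho>}) = u' x" if "x \<in> {- \<rho>..1 + \<rho>}" for x
    using \<open>\<rho> > 0\<close> that by (intro vector_derivative_within_interval u') auto
  have "weighted \<rho> (node0 \<rho> 1) u = avg_r \<rho> (\<lambda>_. 1) * (LINT x:{- \<rho>..\<rho>}|lborel. eta_l \<rho> x * u' x)"
    by (subst weighted_separable[where p = u' and q = "\<lambda>_. 0"])
      (use sub(1) in \<open>auto simp: cont node0_def d avg_r_def I_rho_def\<close>)
  also have "(LINT x:{- \<rho>..\<rho>}|lborel. eta_l \<rho> x * u' x)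
      = - (LINT x:{- \<rho>..\<rho>}|lborel. deriv (eta_l \<rho>) x * u x)"
    using \<open>\<rho> > 0\<close> sub(1) cont
    by (intro average_by_parts smooth_eta_l eta_boundary DERIV_subset[OF u' sub(1)]) auto
  finally show "weighted \<rho> (node0 \<rho> 1) u
      = - avg_r \<rho> (\<lambda>_. 1) * (LINT x:{- \<rho>..\<rho>}|lborel. deriv (eta_l \<rho>) x * u x)"
    by simp
  have "weighted \<rho> (node0 \<rho> 2) u = avg_l \<rho> (\<lambda>_. 1) * (LINT x:{1 - \<rho>..1 + \<rho>}|lborel. eta_r \<rho> x * u' x)"
    by (subst weighted_separable[where p = "\<lambda>_. 0" and q = u'])
      (use sub(2) in \<open>auto simp: cont node0_def d avg_l_def I_rho_def\<close>)
  also have "(LINT x:{1 - \<rho>..1 + \<rho>}|lborel. eta_r \<rho> x * u' x)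
      = - (LINT x:{1 - \<rho>..1 + \<rho>}|lborel. deriv (eta_r \<rho>) x * u x)"
    using \<open>\<rho> > 0\<close> sub(2) cont
    by (intro average_by_parts smooth_eta_r eta_boundary DERIV_subset[OF u' sub(2)]) auto
  finally show "weighted \<rho> (node0 \<rho> 2) u
      = - avg_l \<rho> (\<lambda>_. 1) * (LINT x:{1 - \<rho>..1 + \<rho>}|lborel. deriv (eta_r \<rho>) x * u x)"
    by simp
  have "weighted \<rho> (node0 \<rho> 3) u = avg_r \<rho> (\<lambda>_. 1) * avg_l \<rho> (\<lambda>x. - u x) + avg_l \<rho> (\<lambda>_. 1) * avg_r \<rho> u"
    by (subst weighted_separable[where p = "\<lambda>x. - u x" and q = u])
      (auto simp: cont continuous_on_minus node0_def avg_l_def avg_r_def)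
  then show "weighted \<rho> (node0 \<rho> 3) u
      = avg_l \<rho> (\<lambda>_. 1) * avg_r \<rho> u + - avg_r \<rho> (\<lambda>_. 1) * avg_l \<rho> u"
    by (simp add: avg_l_def set_lebesgue_integral_def)
qed

lemma L1_lipschitz_node0:
  assumes "\<rho> > 0" and i: "i \<in> {1, 2, 3}"
  shows "L1_lipschitz (- \<rho>) (1 + \<rho>) (C1_space (I_rho \<rho>)) (weighted \<rho> (node0 \<rho> i))"
proof -
  note avg = L1_lipschitz_subset[OF L1_lipschitz_avg(1)[OF \<open>\<rho> > 0\<close>, folded I_rho_def] C1_space_subset_C0_space]
    L1_lipschitz_subset[OF L1_lipschitz_avg(2)[OF \<open>\<rho> > 0\<close>, folded I_rho_def] C1_space_subset_C0_space]
  have deriv: "L1_lipschitz (- \<rho>) (1 + \<rho>) (C1_space (I_rho \<rho>)) (\<lambda>u. LINT x:{- \<rho>..\<rho>}|lborel. deriv (eta_l \<rho>) x * u x)"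
    "L1_lipschitz (- \<rho>) (1 + \<rho>) (C1_space (I_rho \<rho>)) (\<lambda>u. LINT x:{1 - \<rho>..1 + \<rho>}|lborel. deriv (eta_r \<rho>) x * u x)"
    unfolding I_rho_def using \<open>\<rho> > 0\<close>
    by (intro L1_lipschitz_subset[OF L1_lipschitz_average C1_space_subset_C0_space]
        smooth_imp_continuous_on smooth_deriv smooth_eta_l smooth_eta_r; simp)+
  consider "i = 1" | "i = 2" | "i = 3"
    using i by auto
  then show ?thesis
  proof cases
    case 1
    show ?thesis
      unfolding 1 by (rule L1_lipschitz_cong[OF L1_lipschitz_scale[OF deriv(1)]])
        (rule weighted_node0[OF \<open>\<rho> > 0\<close>])
  next
    case 2
    show ?thesis
      unfolding 2 by (rule L1_lipschitz_cong[OF L1_lipschitz_scale[OF deriv(2)]])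
        (rule weighted_node0[OF \<open>\<rho> > 0\<close>])
  next
    case 3
    show ?thesis
      unfolding 3 by (rule L1_lipschitz_cong[OF L1_lipschitz_lincomb[OF avg(2,1)]])
        (rule weighted_node0[OF \<open>\<rho> > 0\<close>])
  qed
qed

lemma weighted_node0_eq_node1:
  assumes "\<rho> > 0" and i: "i \<in> {1, 2, 3}" and w: "continuous_on (I_rho \<rho>) w"
    and W: "\<And>x. x \<in> I_rho \<rho> \<Longrightarrow> (W has_real_derivative w x) (at x within I_rho \<rho>)"
  shows "weighted \<rho> (node0 \<rho> i) W = weighted \<rho> (node1 i) w"
proof -
  have "node0 \<rho> i x y W = node1 i x y w" if "x \<in> B_l \<rho>" "y \<in> B_r \<rho>" for x y
  proof -
    have xy: "x \<in> {- \<rho>..1 + \<rho>}" "y \<in> {- \<rho>..1 + \<rho>}"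
      using that \<open>\<rho> > 0\<close> by (auto simp: B_l_eq B_r_eq)
    note W = W[unfolded I_rho_def]
    have "vector_derivative W (at t within {- \<rho>..1 + \<rho>}) = w t" if "t \<in> {- \<rho>..1 + \<rho>}" for t
      using \<open>\<rho> > 0\<close> that by (intro vector_derivative_within_interval W) auto
    moreover have "(LBINT t=x..y. w t) = W y - W x"
      using w xy W by (intro interval_integral_antiderivative[of "- \<rho>" "1 + \<rho>"]) (auto simp: I_rho_def)
    ultimately show ?thesis
      using i xy by (auto simp: node0_def node1_def I_rho_def)
  qed
  then show ?thesis
    unfolding weighted_def by (intro set_lebesgue_integral_cong) (auto intro!: set_lebesgue_integral_cong simp: B_l_eq B_r_eq)
qed

lemma wnode0_eq_wnode1:
  assumes "\<rho> > 0" and i: "i \<in> {1, 2, 3}"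
    and u: "u \<in> L2_space (I_rho \<rho>)" and v: "v \<in> L2_space (I_rho \<rho>)"
    and weak: "has_weak_derivative (I_rho \<rho>) u v"
  shows "wnode0 \<rho> i u = wnode1 \<rho> i v"
proof -
  note I = I_rho_def[of \<rho>]
  have ab: "- \<rho> < 1 + \<rho>"
    using \<open>\<rho> > 0\<close> by simp
  obtain w where w: "\<And>n. continuous_on {- \<rho>..1 + \<rho>} (w n)"
    and wlim: "(\<lambda>n. L2_norm {- \<rho>..1 + \<rho>} (\<lambda>x. w n x - v x)) \<longlonglongrightarrow> 0"
    using continuous_approximating_sequence[OF v[unfolded I]] by auto
  have "(\<lambda>n. LINT x|lebesgue_on {- \<rho>..1 + \<rho>}. \<bar>w n x - v x\<bar>) \<longlonglongrightarrow> 0"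
    using v w by (intro L1_tendsto_of_L2_norm_tendsto[OF ab _ _ wlim]) (auto simp: I intro: continuous_imp_L2_space)
  then have "\<exists>c. (\<lambda>n. L2_norm {- \<rho>..1 + \<rho>} (\<lambda>x. (integral {- \<rho>..x} (w n) + c) - u x)) \<longlonglongrightarrow> 0"
    using u v weak w ab unfolding I by (intro approximate_by_antiderivatives)
  then obtain c where
    Wlim: "(\<lambda>n. L2_norm {- \<rho>..1 + \<rho>} (\<lambda>x. (integral {- \<rho>..x} (w n) + c) - u x)) \<longlonglongrightarrow> 0"
    by (elim exE)
  define W where "W n x = integral {- \<rho>..x} (w n) + c" for n x
  have W: "(W n has_real_derivative w n x) (at x within {- \<rho>..1 + \<rho>})" if "x \<in> {- \<rho>..1 + \<rho>}" for n x
    unfolding W_def using DERIV_add[OF indefinite_integral_has_derivative[OF w that] DERIV_const] by simp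
  have C0: "w n \<in> C0_space {- \<rho>..1 + \<rho>}" and C1: "W n \<in> C1_space {- \<rho>..1 + \<rho>}" for n
    unfolding C0_space_def C1_space_def mem_Collect_eq
    by (intro w, intro exI[of _ "w n"] conjI ballI w W)
  have C0_L2: "C0_space {- \<rho>..1 + \<rho>} \<subseteq> L2_space {- \<rho>..1 + \<rho>}"
    by (auto simp: C0_space_def intro: continuous_imp_L2_space)
  note C1_L2 = order_trans[OF C1_space_subset_C0_space C0_L2]
  have eq: "weighted \<rho> (node0 \<rho> i) (W n) = weighted \<rho> (node1 i) (w n)" for n
    using w W by (intro weighted_node0_eq_node1 \<open>\<rho> > 0\<close> i) (auto simp: I)
  note lip0 = L1_lipschitz_node0[OF \<open>\<rho> > 0\<close> i, unfolded I]
    and lip1 = L1_lipschitz_node1[OF \<open>\<rho> > 0\<close> i, unfolded I]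
  \<comment> \<open>The limit stays unknown: it exists because the values form a Cauchy sequence. By
    \<open>eq\<close> the functionals on 0-forms yield the very same sequence along
    \<open>W\<close>, so both extensions equal \<open>l\<close>.\<close>
  obtain l where l: "(\<lambda>n. weighted \<rho> (node1 i) (w n)) \<longlonglongrightarrow> l"
    using L1_lipschitz_convergent[where w = w, OF ab C0_L2 lip1 v[unfolded I] C0 wlim] by (auto simp: convergent_def)
  have "wnode1 \<rho> i v = l"
    unfolding wnode1_def I by (rule L2_extension_eq[where w = w, OF ab C0_L2 lip1 v[unfolded I] C0 wlim l])
  moreover have "wnode0 \<rho> i u = l"
    unfolding wnode0_def I
    by (rule L2_extension_eq[where w = W, OF ab C1_L2 lip0 u[unfolded I] C1 Wlim[folded W_def]]) (simp add: eq l)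
  ultimately show ?thesis
    by simp
qed

theorem lemma5p5:
  fixes \<rho> :: real and u :: "real \<Rightarrow> real"
  assumes "0 < \<rho>" and "\<rho> \<le> 1/3"
    and "u \<in> HLambda0 (I_rho \<rho>)"
  shows "Pi0 \<rho> u \<in> HLambda0 (I_rho \<rho>) \<and>
         (AE x in lebesgue_on (I_rho \<rho>). d0 (I_rho \<rho>) (Pi0 \<rho> u) x = Pi1 \<rho> (d0 (I_rho \<rho>) u) x)"
proof -
  define v where "v = d0 (I_rho \<rho>) u"
  have v: "v \<in> L2_space (I_rho \<rho>)" "has_weak_derivative (I_rho \<rho>) u v"
    using d0_weak_derivative[OF assms(3)] by (simp_all add: v_def)
  have nodes: "wnode0 \<rho> i u = wnode1 \<rho> i v" if "i \<in> {1, 2, 3}" for i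
    using assms(1,3) v that by (intro wnode0_eq_wnode1) (auto simp: HLambda0_def)
  \<comment> \<open>The fourth coefficient is kept as an unevaluated real number: it multiplies a
    constant, so its value disappears on differentiation.\<close>
  have Pi0: "Pi0 \<rho> u = (\<lambda>x. wnode1 \<rho> 1 v * (x - 2 * x^2 + x^3) + wnode1 \<rho> 2 v * (- (x^2) + x^3)
      + wnode1 \<rho> 3 v * (- 1/2 + 3 * x^2 - 2 * x^3) + wnode0 \<rho> 4 u * (1/2))"
  proof
    fix x
    have "{1..4::nat} = {1, 2, 3, 4}"
      by auto
    then show "Pi0 \<rho> u x = wnode1 \<rho> 1 v * (x - 2 * x^2 + x^3) + wnode1 \<rho> 2 v * (- (x^2) + x^3)
        + wnode1 \<rho> 3 v * (- 1/2 + 3 * x^2 - 2 * x^3) + wnode0 \<rho> 4 u * (1/2)"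
      by (simp add: Pi0_def phi0_def nodes)
  qed
  have Pi1: "Pi1 \<rho> v = (\<lambda>x. wnode1 \<rho> 1 v * (1 - 4 * x + 3 * x^2) + wnode1 \<rho> 2 v * (- 2 * x + 3 * x^2)
      + wnode1 \<rho> 3 v * (6 * x - 6 * x^2))"
  proof
    fix x
    have "{1..3::nat} = {1, 2, 3}"
      by auto
    then show "Pi1 \<rho> v x = wnode1 \<rho> 1 v * (1 - 4 * x + 3 * x^2) + wnode1 \<rho> 2 v * (- 2 * x + 3 * x^2)
        + wnode1 \<rho> 3 v * (6 * x - 6 * x^2)"
      by (simp add: Pi1_def phi1_def)
  qed
  have deriv: "(Pi0 \<rho> u has_real_derivative Pi1 \<rho> v x) (at x within S)" for x S
    unfolding Pi0 Pi1 by (auto intro!: derivative_eq_intros)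
  have cont: "continuous_on S (Pi1 \<rho> v)" "continuous_on S (Pi0 \<rho> u)" for S
    unfolding Pi0 Pi1 by (intro continuous_intros)+
  have weak: "has_weak_derivative (I_rho \<rho>) (Pi0 \<rho> u) (Pi1 \<rho> v)"
    unfolding I_rho_def using assms(1)
    by (intro has_derivative_imp_has_weak_derivative deriv cont) simp
  have L2: "Pi1 \<rho> v \<in> L2_space (I_rho \<rho>)" "Pi0 \<rho> u \<in> L2_space (I_rho \<rho>)"
    unfolding I_rho_def by (intro continuous_imp_L2_space cont)+
  then have H: "Pi0 \<rho> u \<in> HLambda0 (I_rho \<rho>)"
    using weak by (auto simp: HLambda0_def)
  \<comment> \<open>The polynomial \<open>Pi1 \<rho> v\<close> is a classical, hence a weak,
    derivative of \<open>Pi0 \<rho> u\<close>. The choice made by \<open>d0\<close> is another one,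
    and uniqueness relates the two up to a null set.\<close>
  have "AE x in lebesgue_on (I_rho \<rho>). d0 (I_rho \<rho>) (Pi0 \<rho> u) x = Pi1 \<rho> v x"
    using assms(1) L2(1) weak d0_weak_derivative[OF H] unfolding I_rho_def
    by (intro has_weak_derivative_unique) auto
  then show ?thesis
    using H by (simp add: v_def)
qed

end
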